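(* Let $\Gamma$ be a group equipped with a length function $l=l_\Gamma$ that fits in a short exact sequence of groups \[ 1 \rightarrow H \rightarrow \Gamma \stackrel{\pi}{\rightarrow} G \rightarrow 1. \] Define a length function $l_G$ on $G$ by setting $l_G(\pi(x))=\inf\{l(y)\mid y\in\Gamma,\ \pi(y)=\pi(x)\}$ for $x\in\Gamma$. If $G$, with the metric induced by $l_G$, has polynomial growth and if $H$, with the metric induced by the restriction of $l_\Gamma$ to $H$, has Hilbert space compression $\delta$, then the Hilbert space compression of $\Gamma$ (with the metric induced by $l_\Gamma$) is at least $\delta/4$.
   Context: A length function on a group $G$ is a function $l:G\to[0,\infty)$ such that $l(x)=0$ if and only if $x=1$, $l(x)=l(x^{-1})$ for all $x$, and $l(xy)\le l(x)+l(y)$ for all $x,y$. It induces the left-invariant metric $d(x,y)=l(x^{-1}y)$. A metric space $X$ has polynomial growth if there is a polynomial $P$ such that $|\overline{B(x,R)}|\le P(R)$ for every $x\in X$ and every $R\ge 0$, where $\overline{B(x,R)}$ is the closed ball of radius $R$ and center $x$. The Hilbert space compression of a metric space $(X,d)$ is the supremum of all $\delta\in[0,1]$ for which there exist a Hilbert space $\mathcal{H}$, a map $f:X\to\mathcal{H}$ and constants $C,C'>0$, $D,D'\ge 0$ with \[ \tfrac{1}{C'}\,d(x,y)^{\delta}-D'\ \le\ \|f(x)-f(y)\|\ \le\ C\,d(x,y)+D\quad\text{for all }x,y\in X. \] *)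

theory Defs
  imports "HOL-Analysis.Analysis" "HOL-Algebra.Coset" "HOL-Algebra.Module"
begin

section \<open>Length functions and growth\<close>

definition length_function :: "('g, 'm) monoid_scheme \<Rightarrow> ('g \<Rightarrow> real) \<Rightarrow> bool" where
  "length_function G l \<longleftrightarrow>
     (\<forall>x\<in>carrier G. 0 \<le> l x) \<and>
     (\<forall>x\<in>carrier G. l x = 0 \<longleftrightarrow> x = \<one>\<^bsub>G\<^esub>) \<and>
     (\<forall>x\<in>carrier G. l (inv\<^bsub>G\<^esub> x) = l x) \<and>
     (\<forall>x\<in>carrier G. \<forall>y\<in>carrier G. l (x \<otimes>\<^bsub>G\<^esub> y) \<le> l x + l y)"

definition length_dist :: "('g, 'm) monoid_scheme \<Rightarrow> ('g \<Rightarrow> real) \<Rightarrow> 'g \<Rightarrow> 'g \<Rightarrow> real" where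
  "length_dist G l x y = l (inv\<^bsub>G\<^esub> x \<otimes>\<^bsub>G\<^esub> y)"

definition polynomial_growth :: "'a set \<Rightarrow> ('a \<Rightarrow> 'a \<Rightarrow> real) \<Rightarrow> bool" where
  "polynomial_growth X d \<longleftrightarrow>
     (\<exists>P :: real poly. \<forall>x\<in>X. \<forall>R\<ge>0.
        finite {y \<in> X. d x y \<le> R} \<and> real (card {y \<in> X. d x y \<le> R}) \<le> poly P R)"

section \<open>Hilbert spaces with explicit carrier\<close>

text \<open>The compression of a metric space quantifies existentially over Hilbert spaces, which
  a type class cannot express.  So a (real) Hilbert space is a vector space over the reals, given
  as an HOL-Algebra module record whose ring multiplication and unit fields are irrelevant,
  together with an inner product.  Complex Hilbert spaces are covered through the real part of
  their inner product, which induces the same norm.\<close>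

definition real_ring :: "real ring" where
  "real_ring = \<lparr>carrier = UNIV, mult = (*), one = 1, zero = 0, add = (+)\<rparr>"

lemma cring_real_ring: "cring real_ring"
proof (rule cringI)
  show "abelian_group real_ring"
    by (rule abelian_groupI) (auto simp: real_ring_def intro: exI[of _ "- _"])
  show "comm_monoid real_ring"
    by (rule comm_monoidI) (auto simp: real_ring_def)
qed (auto simp: real_ring_def algebra_simps)

locale real_inner_space = Module.module real_ring V for V :: "(real, 'v) module" (structure) +
  fixes ip :: "'v \<Rightarrow> 'v \<Rightarrow> real"
  assumes ip_commute: "\<lbrakk>x \<in> carrier V; y \<in> carrier V\<rbrakk> \<Longrightarrow> ip x y = ip y x"
    and ip_add_left:
      "\<lbrakk>x \<in> carrier V; y \<in> carrier V; z \<in> carrier V\<rbrakk> \<Longrightarrow> ip (x \<oplus> y) z = ip x z + ip y z"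
    and ip_smult_left: "\<lbrakk>x \<in> carrier V; y \<in> carrier V\<rbrakk> \<Longrightarrow> ip (a \<odot> x) y = a * ip x y"
    and ip_nonneg: "x \<in> carrier V \<Longrightarrow> 0 \<le> ip x x"
    and ip_eq_0_iff: "x \<in> carrier V \<Longrightarrow> ip x x = 0 \<longleftrightarrow> x = \<zero>"
begin

definition vnorm :: "'v \<Rightarrow> real" where
  "vnorm x = sqrt (ip x x)"

end

locale hilbert_space = real_inner_space +
  assumes complete:
    "\<lbrakk>\<And>n::nat. \<sigma> n \<in> carrier V;
      \<forall>e>0. \<exists>N. \<forall>m\<ge>N. \<forall>n\<ge>N. vnorm (\<sigma> m \<ominus> \<sigma> n) < e\<rbrakk>
     \<Longrightarrow> \<exists>x\<in>carrier V. (\<lambda>n. vnorm (\<sigma> n \<ominus> x)) \<longlonglongrightarrow> 0"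

section \<open>Hilbert space compression\<close>

text \<open>Note that \<open>0 powr 0 = 0\<close>; for exponent \<open>0\<close> this is immaterial because of the
  additive constant \<open>D'\<close>.\<close>

definition compresses_into ::
  "'a set \<Rightarrow> ('a \<Rightarrow> 'a \<Rightarrow> real) \<Rightarrow> real \<Rightarrow> (real, 'v) module \<Rightarrow> ('v \<Rightarrow> 'v \<Rightarrow> real) \<Rightarrow> bool" where
  "compresses_into X d \<delta> V ip \<longleftrightarrow>
     (\<exists>f \<in> X \<rightarrow> carrier V. \<exists>C C' D D' :: real. C > 0 \<and> C' > 0 \<and> D \<ge> 0 \<and> D' \<ge> 0 \<and>
        (\<forall>x\<in>X. \<forall>y\<in>X.
           1 / C' * d x y powr \<delta> - D' \<le> real_inner_space.vnorm ip (f x \<ominus>\<^bsub>V\<^esub> f y) \<and>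
           real_inner_space.vnorm ip (f x \<ominus>\<^bsub>V\<^esub> f y) \<le> C * d x y + D))"

text \<open>The Hilbert spaces range over those whose vectors are functions on the points, with
  arbitrary vector space structure and inner product.  This is no restriction: the lemmas
  \<open>compression_exponentI\<close> and \<open>compression_exponent_typeI\<close> below show that Hilbert spaces over
  any other type yield no further exponents.\<close>

definition compression_exponents :: "'a set \<Rightarrow> ('a \<Rightarrow> 'a \<Rightarrow> real) \<Rightarrow> real set" where
  "compression_exponents X d =
     {\<delta> \<in> {0..1}. \<exists>(V :: (real, 'a \<Rightarrow> real) module) ip.
        hilbert_space V ip \<and> compresses_into X d \<delta> V ip}"

definition hilbert_compression :: "'a set \<Rightarrow> ('a \<Rightarrow> 'a \<Rightarrow> real) \<Rightarrow> real" where
  "hilbert_compression X d = Sup (compression_exponents X d)"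

section \<open>Independence of the type of vectors\<close>

context real_inner_space
begin

lemma ip_add_right:
  "\<lbrakk>x \<in> carrier V; y \<in> carrier V; z \<in> carrier V\<rbrakk> \<Longrightarrow> ip z (x \<oplus> y) = ip z x + ip z y"
  using ip_add_left ip_commute by (metis M.a_closed)

lemma smult_in: "x \<in> carrier V \<Longrightarrow> a \<odot> x \<in> carrier V"
  by (rule smult_closed) (simp_all add: real_ring_def)

lemma ip_smult_right: "\<lbrakk>x \<in> carrier V; y \<in> carrier V\<rbrakk> \<Longrightarrow> ip y (a \<odot> x) = a * ip y x"
  using ip_smult_left ip_commute smult_in by metis

lemma ip_zero_left: "x \<in> carrier V \<Longrightarrow> ip \<zero> x = 0"
  using ip_add_left[of \<zero> \<zero> x] by simp

lemma ip_minus_left: "\<lbrakk>x \<in> carrier V; y \<in> carrier V\<rbrakk> \<Longrightarrow> ip (\<ominus> x) y = - ip x y"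
  using ip_add_left[of "\<ominus> x" x y] ip_zero_left[of y] by (simp add: M.l_neg)

lemma ip_diff_left:
  "\<lbrakk>x \<in> carrier V; y \<in> carrier V; z \<in> carrier V\<rbrakk> \<Longrightarrow> ip (x \<ominus> y) z = ip x z - ip y z"
  by (simp add: a_minus_def ip_add_left ip_minus_left)

lemma ip_diff_right:
  "\<lbrakk>x \<in> carrier V; y \<in> carrier V; z \<in> carrier V\<rbrakk> \<Longrightarrow> ip z (x \<ominus> y) = ip z x - ip z y"
  using ip_diff_left ip_commute by (metis M.minus_closed)

lemma Cauchy_Schwarz:
  assumes x: "x \<in> carrier V" and y: "y \<in> carrier V"
  shows "\<bar>ip x y\<bar> \<le> vnorm x * vnorm y"
proof -
  have "(ip x y)\<^sup>2 \<le> ip x x * ip y y"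
  proof (cases "ip y y = 0")
    case True
    then have "y = \<zero>" using ip_eq_0_iff y by blast
    then show ?thesis using True ip_zero_left[of x] ip_commute[OF x y] x by simp
  next
    case False
    define t where "t = ip x y / ip y y"
    have c: "t \<odot> y \<in> carrier V" using y by (rule smult_in)
    have "0 \<le> ip (x \<ominus> t \<odot> y) (x \<ominus> t \<odot> y)"
      by (rule ip_nonneg) (use x c in auto)
    also have "\<dots> = ip x x - 2 * t * ip x y + t * t * ip y y"
      using x y c ip_commute[OF x y]
      by (simp add: ip_diff_left ip_diff_right ip_smult_left ip_smult_right M.minus_closed algebra_simps)
    also have "\<dots> = ip x x - (ip x y)\<^sup>2 / ip y y"
      using False by (simp add: t_def field_simps power2_eq_square)
    finally show ?thesis
      using False ip_nonneg[OF y] by (simp add: field_simps)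
  qed
  then have "sqrt ((ip x y)\<^sup>2) \<le> sqrt (ip x x * ip y y)"
    by (rule real_sqrt_le_mono)
  then show ?thesis
    by (simp add: vnorm_def real_sqrt_mult)
qed

end

text \<open>The closed span of \<open>f ` X\<close>, described as its double orthogonal complement, is moved to a
  space of functions on \<open>X\<close> by sending \<open>w\<close> to \<open>\<lambda>x. \<langle>w, f x\<rangle>\<close>.\<close>

lemma compression_exponentI:
  fixes X :: "'a set" and V :: "(real, 'v) module"
  assumes hs: "hilbert_space V ip" and comp: "compresses_into X d \<delta> V ip" and \<delta>: "\<delta> \<in> {0..1}"
  shows "\<delta> \<in> compression_exponents X d"
proof -
  interpret V: hilbert_space V ip by (fact hs)
  obtain f C C' D D' where f: "f \<in> X \<rightarrow> carrier V" and
    est: "C > 0" "C' > 0" "D \<ge> 0" "D' \<ge> 0"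
      "\<And>x y. \<lbrakk>x \<in> X; y \<in> X\<rbrakk> \<Longrightarrow> 1 / C' * d x y powr \<delta> - D' \<le> V.vnorm (f x \<ominus>\<^bsub>V\<^esub> f y)"
      "\<And>x y. \<lbrakk>x \<in> X; y \<in> X\<rbrakk> \<Longrightarrow> V.vnorm (f x \<ominus>\<^bsub>V\<^esub> f y) \<le> C * d x y + D"
    using comp unfolding compresses_into_def by blast
  have fin: "f x \<in> carrier V" if "x \<in> X" for x using f that by blast
  define W where "W = {w \<in> carrier V. \<forall>v\<in>carrier V. (\<forall>x\<in>X. ip v (f x) = 0) \<longrightarrow> ip v w = 0}"
  have WV: "w \<in> carrier V" if "w \<in> W" for w using that by (simp add: W_def)
  have fW: "f x \<in> W" if "x \<in> X" for x using that fin by (simp add: W_def)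
  have W0: "\<zero>\<^bsub>V\<^esub> \<in> W"
    unfolding W_def using V.ip_zero_left V.ip_commute by auto
  have Wadd: "w \<oplus>\<^bsub>V\<^esub> w' \<in> W" if "w \<in> W" "w' \<in> W" for w w'
    using that by (auto simp: W_def V.ip_add_right)
  have Wsmult: "a \<odot>\<^bsub>V\<^esub> w \<in> W" if "w \<in> W" for w a
    using that by (auto simp: W_def V.ip_smult_right V.smult_in)
  have Wdiff: "w \<ominus>\<^bsub>V\<^esub> w' \<in> W" if "w \<in> W" "w' \<in> W" for w w'
    using that by (auto simp: W_def V.ip_diff_right V.M.minus_closed)
  define \<phi> where "\<phi> w = (\<lambda>x. if x \<in> X then ip w (f x) else 0)" for w
  have \<phi>_add: "\<phi> (w \<oplus>\<^bsub>V\<^esub> w') = (\<lambda>x. \<phi> w x + \<phi> w' x)" if "w \<in> W" "w' \<in> W" for w w'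
    using that by (auto simp: \<phi>_def V.ip_add_left WV fin)
  have \<phi>_diff: "\<phi> (w \<ominus>\<^bsub>V\<^esub> w') = (\<lambda>x. \<phi> w x - \<phi> w' x)" if "w \<in> W" "w' \<in> W" for w w'
    using that by (auto simp: \<phi>_def V.ip_diff_left WV fin)
  have \<phi>_smult: "\<phi> (a \<odot>\<^bsub>V\<^esub> w) = (\<lambda>x. a * \<phi> w x)" if "w \<in> W" for w a
    using that by (auto simp: \<phi>_def V.ip_smult_left WV fin)
  have \<phi>_zero: "\<phi> \<zero>\<^bsub>V\<^esub> = (\<lambda>x. 0)"
    by (auto simp: \<phi>_def V.ip_zero_left fin)
  have ker: "w = \<zero>\<^bsub>V\<^esub>" if w: "w \<in> W" and 0: "\<phi> w = (\<lambda>x. 0)" for w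
  proof -
    have "ip w (f x) = 0" if "x \<in> X" for x
      using fun_cong[OF 0, of x] that by (simp add: \<phi>_def)
    then have "ip w w = 0" using w by (auto simp: W_def)
    then show ?thesis using V.ip_eq_0_iff WV[OF w] by blast
  qed
  have inj: "inj_on \<phi> W"
  proof (rule inj_onI)
    fix w w' assume w: "w \<in> W" "w' \<in> W" and eq: "\<phi> w = \<phi> w'"
    have "w \<ominus>\<^bsub>V\<^esub> w' = \<zero>\<^bsub>V\<^esub>"
      by (rule ker) (use w eq in \<open>simp_all add: Wdiff \<phi>_diff\<close>)
    then have "\<ominus>\<^bsub>V\<^esub> (\<ominus>\<^bsub>V\<^esub> w') = w"
      using w WV by (intro V.M.minus_equality) (simp_all add: a_minus_def)
    then show "w = w'" using w WV by simp
  qed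
  define \<psi> where "\<psi> = inv_into W \<phi>"
  have \<psi>: "\<psi> (\<phi> w) = w" if "w \<in> W" for w
    using that inj by (simp add: \<psi>_def)
  define V' :: "(real, 'a \<Rightarrow> real) module" where
    "V' = \<lparr>carrier = \<phi> ` W, mult = undefined, one = undefined,
           zero = (\<lambda>x. 0), add = (\<lambda>g h x. g x + h x), smult = (\<lambda>a g x. a * g x)\<rparr>"
  define ip' where "ip' g h = ip (\<psi> g) (\<psi> h)" for g h
  have V'_simps: "carrier V' = \<phi> ` W" "\<zero>\<^bsub>V'\<^esub> = (\<lambda>x. 0)"
    "\<And>g h. g \<oplus>\<^bsub>V'\<^esub> h = (\<lambda>x. g x + h x)" "\<And>a g. a \<odot>\<^bsub>V'\<^esub> g = (\<lambda>x. a * g x)"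
    by (simp_all add: V'_def)
  have ag: "abelian_group V'"
  proof (rule abelian_groupI)
    show "g \<oplus>\<^bsub>V'\<^esub> h \<in> carrier V'" if "g \<in> carrier V'" "h \<in> carrier V'" for g h
      using that Wadd by (auto simp: V'_simps \<phi>_add[symmetric])
    show "\<zero>\<^bsub>V'\<^esub> \<in> carrier V'" using W0 \<phi>_zero by (force simp: V'_simps)
    show "\<exists>h\<in>carrier V'. h \<oplus>\<^bsub>V'\<^esub> g = \<zero>\<^bsub>V'\<^esub>" if g: "g \<in> carrier V'" for g
    proof -
      obtain w where w: "w \<in> W" "g = \<phi> w" using g by (auto simp: V'_simps)
      show ?thesis
      proof (rule bexI[of _ "\<phi> ((-1) \<odot>\<^bsub>V\<^esub> w)"])
        show "\<phi> ((-1) \<odot>\<^bsub>V\<^esub> w) \<oplus>\<^bsub>V'\<^esub> g = \<zero>\<^bsub>V'\<^esub>"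
          using w by (simp add: V'_simps \<phi>_smult)
        show "\<phi> ((-1) \<odot>\<^bsub>V\<^esub> w) \<in> carrier V'"
          using Wsmult[OF w(1)] unfolding V'_simps by (rule imageI)
      qed
    qed
  qed (auto simp: V'_simps algebra_simps)
  interpret A: abelian_group V' by (fact ag)
  interpret R: cring real_ring by (fact cring_real_ring)
  interpret W: real_inner_space V' ip'
  proof (unfold_locales, goal_cases)
    case (1 a x)
    then show ?case using Wsmult by (auto simp: V'_simps \<phi>_smult[symmetric])
  next
    case (6 x y)
    then show ?case by (auto simp: V'_simps ip'_def \<psi> WV intro: V.ip_commute)
  next
    case (7 x y z)
    then show ?case
      by (auto simp: V'_simps(1,3) ip'_def \<psi> WV \<phi>_add[symmetric] Wadd V.ip_add_left)
  next
    case (8 x y a)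
    then show ?case
      by (auto simp: V'_simps(1,4) ip'_def \<psi> WV \<phi>_smult[symmetric] Wsmult V.ip_smult_left)
  next
    case (9 x)
    then show ?case by (auto simp: V'_simps ip'_def \<psi> WV V.ip_nonneg)
  next
    case (10 x)
    then obtain w where w: "w \<in> W" "x = \<phi> w" by (auto simp: V'_simps)
    then show ?case
      using ker[OF w(1)] \<phi>_zero V.ip_eq_0_iff[OF WV[OF w(1)]] by (auto simp: V'_simps ip'_def \<psi>)
  qed (auto simp: V'_simps real_ring_def algebra_simps)
  have dist: "W.vnorm (\<phi> w \<ominus>\<^bsub>V'\<^esub> \<phi> w') = V.vnorm (w \<ominus>\<^bsub>V\<^esub> w')" if w: "w \<in> W" "w' \<in> W" for w w'
  proof -
    have c: "\<phi> w \<in> carrier V'" "\<phi> w' \<in> carrier V'" "\<phi> (w \<ominus>\<^bsub>V\<^esub> w') \<in> carrier V'"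
      using w Wdiff by (auto simp: V'_simps)
    have "\<phi> w = \<phi> (w \<ominus>\<^bsub>V\<^esub> w') \<oplus>\<^bsub>V'\<^esub> \<phi> w'"
      using w by (auto simp: V'_simps \<phi>_diff)
    then have "\<phi> w \<ominus>\<^bsub>V'\<^esub> \<phi> w' = \<phi> (w \<ominus>\<^bsub>V\<^esub> w')"
      using c by (metis A.a_assoc A.a_inv_closed A.r_neg A.r_zero a_minus_def)
    then show ?thesis
      using w by (simp add: W.vnorm_def V.vnorm_def ip'_def \<psi> Wdiff)
  qed
  have "hilbert_space V' ip'"
  proof
    fix \<sigma> :: "nat \<Rightarrow> 'a \<Rightarrow> real"
    assume \<sigma>: "\<And>n. \<sigma> n \<in> carrier V'"
      and cau: "\<forall>e>0. \<exists>N. \<forall>m\<ge>N. \<forall>n\<ge>N. W.vnorm (\<sigma> m \<ominus>\<^bsub>V'\<^esub> \<sigma> n) < e"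
    have "\<forall>n. \<exists>w. w \<in> W \<and> \<sigma> n = \<phi> w"
      using \<sigma> by (auto simp: V'_simps)
    then obtain \<tau> where \<tau>: "\<And>n. \<tau> n \<in> W" "\<And>n. \<sigma> n = \<phi> (\<tau> n)" by metis
    have "\<exists>w\<in>carrier V. (\<lambda>n. V.vnorm (\<tau> n \<ominus>\<^bsub>V\<^esub> w)) \<longlonglongrightarrow> 0"
      by (rule V.complete) (use \<tau> WV cau in \<open>simp_all add: dist\<close>)
    then obtain w where w: "w \<in> carrier V" and lim: "(\<lambda>n. V.vnorm (\<tau> n \<ominus>\<^bsub>V\<^esub> w)) \<longlonglongrightarrow> 0"
      by blast
    have "ip v w = 0" if v: "v \<in> carrier V" "\<forall>x\<in>X. ip v (f x) = 0" for v
    proof -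
      have "\<bar>ip v w\<bar> \<le> V.vnorm v * V.vnorm (\<tau> n \<ominus>\<^bsub>V\<^esub> w)" for n
      proof -
        have "ip v (\<tau> n) = 0" using \<tau>(1)[of n] v by (auto simp: W_def)
        then have "\<bar>ip v w\<bar> = \<bar>ip v (\<tau> n \<ominus>\<^bsub>V\<^esub> w)\<bar>"
          using v w WV[OF \<tau>(1)] by (simp add: V.ip_diff_right)
        also have "\<dots> \<le> V.vnorm v * V.vnorm (\<tau> n \<ominus>\<^bsub>V\<^esub> w)"
          by (rule V.Cauchy_Schwarz) (use v w WV[OF \<tau>(1)] in auto)
        finally show ?thesis .
      qed
      moreover have "(\<lambda>n. V.vnorm v * V.vnorm (\<tau> n \<ominus>\<^bsub>V\<^esub> w)) \<longlonglongrightarrow> V.vnorm v * 0"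
        by (intro tendsto_intros lim)
      ultimately have "\<bar>ip v w\<bar> \<le> V.vnorm v * 0"
        by (intro LIMSEQ_le_const) auto
      then show ?thesis by simp
    qed
    then have wW: "w \<in> W" using w by (simp add: W_def)
    show "\<exists>g\<in>carrier V'. (\<lambda>n. W.vnorm (\<sigma> n \<ominus>\<^bsub>V'\<^esub> g)) \<longlonglongrightarrow> 0"
      by (rule bexI[of _ "\<phi> w"]) (use wW lim in \<open>simp_all add: V'_simps(1) \<tau> dist\<close>)
  qed
  moreover have "compresses_into X d \<delta> V' ip'"
    unfolding compresses_into_def
    by (rule bexI[of _ "\<phi> \<circ> f"], rule exI[of _ C], rule exI[of _ C'], rule exI[of _ D], rule exI[of _ D'])
       (use est in \<open>auto simp: dist fW V'_simps(1)\<close>)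
  ultimately show ?thesis
    using \<delta> unfolding compression_exponents_def by blast
qed

lemma compression_exponent_typeI:
  fixes f :: "'a \<Rightarrow> 'h :: {real_inner, complete_space}" and C C' D D' \<delta> :: real
  assumes "\<delta> \<in> {0..1}" "C > 0" "C' > 0" "D \<ge> 0" "D' \<ge> 0"
    and "\<And>x y. \<lbrakk>x \<in> X; y \<in> X\<rbrakk> \<Longrightarrow> 1 / C' * d x y powr \<delta> - D' \<le> norm (f x - f y)"
    and "\<And>x y. \<lbrakk>x \<in> X; y \<in> X\<rbrakk> \<Longrightarrow> norm (f x - f y) \<le> C * d x y + D"
  shows "\<delta> \<in> compression_exponents X d"
proof -
  define V :: "(real, 'h) module" where
    "V = \<lparr>carrier = UNIV, mult = undefined, one = undefined, zero = 0, add = (+), smult = (*\<^sub>R)\<rparr>"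
  have V_simps: "carrier V = UNIV" "\<zero>\<^bsub>V\<^esub> = 0" "\<And>g h. g \<oplus>\<^bsub>V\<^esub> h = g + h"
    "\<And>a g. a \<odot>\<^bsub>V\<^esub> g = a *\<^sub>R g"
    by (simp_all add: V_def)
  have ag: "abelian_group V"
    by (rule abelian_groupI) (auto simp: V_simps algebra_simps intro: exI[of _ "- _"])
  interpret A: abelian_group V by (fact ag)
  interpret R: cring real_ring by (fact cring_real_ring)
  interpret V: real_inner_space V inner
    by (unfold_locales)
       (auto simp: V_simps real_ring_def algebra_simps inner_commute inner_add_left)
  have minus: "g \<ominus>\<^bsub>V\<^esub> h = g - h" for g h
    using A.minus_equality[of "- h" h] by (simp add: V_simps a_minus_def)
  have norm: "V.vnorm g = norm g" for g
    by (simp add: V.vnorm_def norm_eq_sqrt_inner)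
  have "hilbert_space V inner"
  proof
    fix \<sigma> :: "nat \<Rightarrow> 'h"
    assume "\<forall>e>0. \<exists>N. \<forall>m\<ge>N. \<forall>n\<ge>N. V.vnorm (\<sigma> m \<ominus>\<^bsub>V\<^esub> \<sigma> n) < e"
    then have "Cauchy \<sigma>"
      by (simp add: Cauchy_def norm minus dist_norm)
    then obtain x where "\<sigma> \<longlonglongrightarrow> x"
      using Cauchy_convergent convergent_def by blast
    then show "\<exists>x\<in>carrier V. (\<lambda>n. V.vnorm (\<sigma> n \<ominus>\<^bsub>V\<^esub> x)) \<longlonglongrightarrow> 0"
      by (auto simp: V_simps norm minus tendsto_norm_zero_iff LIM_zero_iff)
  qed
  moreover have "compresses_into X d \<delta> V inner"
    unfolding compresses_into_def
    by (rule bexI[of _ f], rule exI[of _ C], rule exI[of _ C'], rule exI[of _ D], rule exI[of _ D'])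
       (use assms in \<open>auto simp: norm minus V_simps\<close>)
  ultimately show ?thesis
    using assms(1) by (rule compression_exponentI)
qed

text \<open>The supremum is taken over a nonempty set, bounded above by 1.\<close>

lemma zero_compression_exponent:
  assumes "\<And>x y. \<lbrakk>x \<in> X; y \<in> X\<rbrakk> \<Longrightarrow> 0 \<le> d x y"
  shows "0 \<in> compression_exponents X d"
  by (rule compression_exponent_typeI[where f = "\<lambda>_. 0 :: real" and C = 1 and C' = 1 and D = 0 and D' = 1])
     (use assms in auto)

end

theory Submission
  imports Defs
begin

text \<open>Every positive compression exponent \<open>e\<close> of \<open>H\<close> yields the exponent \<open>e / 4\<close> of
  \<open>\<Gamma>\<close> (\<open>extension_compression_exponent\<close>), and the theorem follows by taking suprema.

  The idea is to spread each point \<open>x\<close> of \<open>\<Gamma>\<close> over the fibres of \<open>\<pi>\<close> near it.  Left translation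
  identifies each fibre with \<open>H\<close>, and \<open>x\<close> has an almost nearest point in every fibre, at
  distance about \<open>d (\<pi> x) g\<close> for the fibre over \<open>g\<close>.  At a scale \<open>R\<close>, take weights \<open>\<phi> x g\<close> on
  \<open>G\<close>, supported in the ball of radius \<open>R\<^sup>2\<close> around \<open>\<pi> x\<close> and of norm 1 as a function of \<open>g\<close>,
  which vary with \<open>x\<close> at rate \<open>1 / R\<close>.  Truncated exponentials do this: by polynomial growth the
  error of the truncation is negligible
  (\<open>polynomial_growth_weights\<close>).  On the fibres use a Hilbert space embedding \<open>f\<close> of \<open>H\<close>; but since the
  weights of two points differ, unbounded vectors would destroy the upper estimate.  So \<open>f\<close> is
  replaced by the unit vectors with inner products
  \<open>exp (- t * \<parallel>f u - f v\<parallel>\<^sup>2)\<close>.  Summing the weighted vectors over the fibres gives unit vectors with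
  inner products \<open>k x y\<close>, where \<open>1 - k\<close> is small while \<open>x\<close> and \<open>y\<close> are close and at least
  \<open>1 / 2\<close> once they are far apart.  Adding up these maps over the scales \<open>R = 4 ^ n\<close>, with \<open>t\<close> and
  the factors chosen to balance the two estimates, gives the exponent \<open>e / 4\<close>
  (\<open>fibred_compression_exponent\<close>).

  None of these vectors has to be constructed.  It suffices to know that their inner products form a
  positive definite kernel, for which \<open>Schur_product\<close> and \<open>pos_def_on_Gaussian\<close> are the main tools, and
  that conditionally negative definite kernels are the squares of distances in Hilbert spaces
  (\<open>cond_neg_def_embedding\<close>).\<close>

section \<open>Positive definite kernels\<close>

definition quad_form :: "('a \<Rightarrow> 'a \<Rightarrow> real) \<Rightarrow> 'a set \<Rightarrow> ('a \<Rightarrow> real) \<Rightarrow> real" where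
  "quad_form K S c = (\<Sum>x\<in>S. \<Sum>y\<in>S. c x * c y * K x y)"

definition pos_def_on :: "'a set \<Rightarrow> ('a \<Rightarrow> 'a \<Rightarrow> real) \<Rightarrow> bool" where
  "pos_def_on X K \<longleftrightarrow>
     (\<forall>x\<in>X. \<forall>y\<in>X. K x y = K y x) \<and>
     (\<forall>S c. finite S \<longrightarrow> S \<subseteq> X \<longrightarrow> 0 \<le> quad_form K S c)"

lemma pos_def_onI:
  assumes "\<And>x y. x \<in> X \<Longrightarrow> y \<in> X \<Longrightarrow> K x y = K y x"
    and "\<And>S c. finite S \<Longrightarrow> S \<subseteq> X \<Longrightarrow> 0 \<le> quad_form K S c"
  shows "pos_def_on X K"
  using assms by (auto simp: pos_def_on_def)

lemma pos_def_on_sym: "pos_def_on X K \<Longrightarrow> x \<in> X \<Longrightarrow> y \<in> X \<Longrightarrow> K x y = K y x"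
  by (simp add: pos_def_on_def)

lemma pos_def_on_quad_form:
  "pos_def_on X K \<Longrightarrow> finite S \<Longrightarrow> S \<subseteq> X \<Longrightarrow> 0 \<le> quad_form K S c"
  by (simp add: pos_def_on_def)

lemma pos_def_on_subset: "pos_def_on X K \<Longrightarrow> Y \<subseteq> X \<Longrightarrow> pos_def_on Y K"
  unfolding pos_def_on_def by blast

lemma quad_form_cong:
  assumes "\<And>x y. x \<in> S \<Longrightarrow> y \<in> S \<Longrightarrow> K x y = L x y" and "\<And>x. x \<in> S \<Longrightarrow> b x = c x"
  shows "quad_form K S b = quad_form L S c"
  unfolding quad_form_def using assms by (intro sum.cong refl) simp

lemma pos_def_on_cong:
  assumes "pos_def_on X K" and "\<And>x y. x \<in> X \<Longrightarrow> y \<in> X \<Longrightarrow> L x y = K x y"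
  shows "pos_def_on X L"
proof (rule pos_def_onI)
  fix S c assume "finite S" "S \<subseteq> X"
  moreover have "quad_form L S c = quad_form K S c"
    using assms(2) \<open>S \<subseteq> X\<close> by (intro quad_form_cong) auto
  ultimately show "0 \<le> quad_form L S c"
    using pos_def_on_quad_form[OF assms(1)] by simp
qed (simp add: assms(2) pos_def_on_sym[OF assms(1)])

lemma quad_form_mono_neutral:
  assumes "finite U" "S \<subseteq> U"
  shows "quad_form K U (\<lambda>x. if x \<in> S then c x else 0) = quad_form K S c"
proof -
  have "quad_form K U (\<lambda>x. if x \<in> S then c x else 0)
      = (\<Sum>x\<in>S. \<Sum>y\<in>U. c x * (if y \<in> S then c y else 0) * K x y)"
    unfolding quad_form_def using assms by (intro sum.mono_neutral_cong_right) auto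
  also have "\<dots> = quad_form K S c"
    unfolding quad_form_def using assms
    by (intro sum.cong refl sum.mono_neutral_cong_right) auto
  finally show ?thesis .
qed

lemma quad_form_insert:
  assumes "finite S" "z \<notin> S" and sym: "\<And>x. x \<in> S \<Longrightarrow> K z x = K x z"
  shows "quad_form K (insert z S) c
       = (c z)\<^sup>2 * K z z + 2 * c z * (\<Sum>x\<in>S. c x * K x z) + quad_form K S c"
proof -
  have "(\<Sum>y\<in>S. c z * c y * K z y) = c z * (\<Sum>x\<in>S. c x * K x z)"
    unfolding sum_distrib_left using sym by (intro sum.cong) auto
  moreover have "(\<Sum>x\<in>S. c x * c z * K x z) = c z * (\<Sum>x\<in>S. c x * K x z)"
    unfolding sum_distrib_left by (intro sum.cong) auto
  ultimately show ?thesis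
    using assms(1,2) by (simp add: quad_form_def sum.distrib power2_eq_square)
qed

lemma pos_def_on_diag: "pos_def_on X K \<Longrightarrow> x \<in> X \<Longrightarrow> 0 \<le> K x x"
  using pos_def_on_quad_form[of X K "{x}" "\<lambda>_. 1"] by (simp add: quad_form_def)

text \<open>On two points the form is linear in the coefficient at \<open>z\<close> when \<open>K z z = 0\<close>, so its slope
  has to vanish.\<close>

lemma pos_def_on_zero_row:
  assumes K: "pos_def_on X K" and z: "z \<in> X" "K z z = 0" and x: "x \<in> X"
  shows "K x z = 0"
proof (rule ccontr)
  assume n: "K x z \<noteq> 0"
  then have xz: "x \<noteq> z" using z by auto
  have "0 \<le> quad_form K (insert z {x}) (\<lambda>y. if y = z then - (K x x + 1) / (2 * K x z) else 1)"
    using x z by (intro pos_def_on_quad_form[OF K]) auto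
  also have "\<dots> = - 1"
    using xz n z(2) pos_def_on_sym[OF K x z(1)]
    by (subst quad_form_insert) (auto simp: quad_form_def field_simps)
  finally show False by simp
qed

text \<open>Induction on the index set with one step of symmetric elimination: a pivot row \<open>z\<close> with
  \<open>K z z > 0\<close> splits \<open>K\<close> into a rank one kernel, for which the product is a
  diagonal rescaling of \<open>L\<close>, and a Schur complement that vanishes on that row.\<close>

theorem Schur_product:
  assumes K: "pos_def_on X K" and L: "pos_def_on X L"
  shows "pos_def_on X (\<lambda>x y. K x y * L x y)"
proof (rule pos_def_onI)
  show "K x y * L x y = K y x * L y x" if "x \<in> X" "y \<in> X" for x y
    using that pos_def_on_sym[OF K] pos_def_on_sym[OF L] by simp
next
  fix S :: "'a set" and c :: "'a \<Rightarrow> real"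
  assume S: "finite S" "S \<subseteq> X"
  have "\<forall>K c. pos_def_on S K \<longrightarrow> 0 \<le> quad_form (\<lambda>x y. K x y * L x y) S c"
    using S
  proof (induction S rule: finite_induct)
    case empty
    then show ?case by (simp add: quad_form_def)
  next
    case (insert z S)
    show ?case
    proof (intro allI impI)
      fix K :: "'a \<Rightarrow> 'a \<Rightarrow> real" and c :: "'a \<Rightarrow> real"
      assume K: "pos_def_on (insert z S) K"
      have LS: "pos_def_on (insert z S) L"
        using L insert.prems by (rule pos_def_on_subset)
      have symK: "K z x = K x z" if "x \<in> S" for x
        using pos_def_on_sym[OF K] that by simp
      have IH: "0 \<le> quad_form (\<lambda>x y. K' x y * L x y) (insert z S) c"
        if K': "pos_def_on S K'" and row: "\<And>x. x \<in> insert z S \<Longrightarrow> K' x z = 0 \<and> K' z x = 0" for K'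
      proof -
        have "quad_form (\<lambda>x y. K' x y * L x y) (insert z S) c
            = quad_form (\<lambda>x y. K' x y * L x y) S c"
          using insert.hyps row by (subst quad_form_insert) auto
        then show ?thesis using insert K' by auto
      qed
      show "0 \<le> quad_form (\<lambda>x y. K x y * L x y) (insert z S) c"
      proof (cases "K z z = 0")
        case True
        have "K x z = 0 \<and> K z x = 0" if "x \<in> insert z S" for x
          using pos_def_on_zero_row[OF K _ True that] symK that by auto
        then show ?thesis
          using K by (intro IH) (auto intro: pos_def_on_subset)
      next
        case False
        then have pos: "K z z > 0" using pos_def_on_diag[OF K, of z] by simp
        define K' where "K' x y = K x y - K x z * K y z / K z z" for x y
        have split: "quad_form (\<lambda>x y. K' x y * M x y) T b
            = quad_form (\<lambda>x y. K x y * M x y) T b - quad_form M T (\<lambda>x. b x * K x z) / K z z" for T M b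
          unfolding quad_form_def K'_def
          by (simp add: algebra_simps sum_subtractf sum_divide_distrib)
        have "pos_def_on S K'"
        proof (rule pos_def_onI)
          show "K' x y = K' y x" if "x \<in> S" "y \<in> S" for x y
            using that pos_def_on_sym[OF K] by (simp add: K'_def)
          fix T b assume T: "finite T" "T \<subseteq> S"
          define s where "s = (\<Sum>x\<in>T. b x * K x z) / K z z"
          have zT: "z \<notin> T" using T insert.hyps by auto
          have "0 \<le> quad_form K (insert z T) (b(z := - s))"
            using T insert.hyps by (intro pos_def_on_quad_form[OF K]) auto
          also have "\<dots> = s\<^sup>2 * K z z - 2 * s * (\<Sum>x\<in>T. (b(z := -s)) x * K x z) + quad_form K T (b(z := -s))"
            using T zT symK by (subst quad_form_insert) auto
          also have "(\<Sum>x\<in>T. (b(z := -s)) x * K x z) = s * K z z"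
            using False zT unfolding s_def by (simp, intro sum.cong) auto
          also have "quad_form K T (b(z := -s)) = quad_form K T b"
            using zT by (intro quad_form_cong) auto
          also have "s\<^sup>2 * K z z - 2 * s * (s * K z z) + quad_form K T b = quad_form K T b - s\<^sup>2 * K z z"
            by (simp add: power2_eq_square)
          also have "s\<^sup>2 * K z z = quad_form (\<lambda>_ _. 1) T (\<lambda>x. b x * K x z) / K z z"
            using False unfolding s_def quad_form_def
            by (simp add: power2_eq_square sum_product)
          also have "quad_form K T b - \<dots> = quad_form K' T b"
            using split[of "\<lambda>_ _. 1" T b] by simp
          finally show "0 \<le> quad_form K' T b" .
        qed
        then have "0 \<le> quad_form (\<lambda>x y. K' x y * L x y) (insert z S) c"
          by (rule IH) (use False symK in \<open>auto simp: K'_def\<close>)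
        moreover have "0 \<le> quad_form L (insert z S) (\<lambda>x. c x * K x z) / K z z"
          using pos insert.hyps by (intro divide_nonneg_pos pos_def_on_quad_form[OF LS]) auto
        ultimately show ?thesis
          using split[of L "insert z S" c] by simp
      qed
    qed
  qed
  then show "0 \<le> quad_form (\<lambda>x y. K x y * L x y) S c"
    using pos_def_on_subset[OF K S(2)] by blast
qed

lemma pos_def_on_rescale:
  assumes "pos_def_on X K"
  shows "pos_def_on X (\<lambda>x y. a x * a y * K x y)"
proof (rule pos_def_onI)
  fix S c assume "finite S" "S \<subseteq> X"
  then have "0 \<le> quad_form K S (\<lambda>x. c x * a x)" by (rule pos_def_on_quad_form[OF assms])
  also have "\<dots> = quad_form (\<lambda>x y. a x * a y * K x y) S c"
    by (simp add: quad_form_def mult_ac)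
  finally show "0 \<le> quad_form (\<lambda>x y. a x * a y * K x y) S c" .
qed (use pos_def_on_sym[OF assms] in simp)

lemma pos_def_on_const: "0 \<le> r \<Longrightarrow> pos_def_on X (\<lambda>_ _. r)"
proof (rule pos_def_onI)
  fix S and c :: "'a \<Rightarrow> real" assume "0 \<le> r"
  moreover have "quad_form (\<lambda>_ _. r) S c = r * (\<Sum>x\<in>S. c x)\<^sup>2"
    by (simp add: quad_form_def power2_eq_square sum_product sum_distrib_left mult_ac)
  ultimately show "0 \<le> quad_form (\<lambda>_ _. r) S c" by simp
qed simp

lemma quad_form_sum: "quad_form (\<lambda>x y. \<Sum>i\<in>I. K i x y) S c = (\<Sum>i\<in>I. quad_form (K i) S c)"
proof -
  have "(\<Sum>i\<in>I. quad_form (K i) S c) = (\<Sum>x\<in>S. \<Sum>i\<in>I. \<Sum>y\<in>S. c x * c y * K i x y)"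
    unfolding quad_form_def by (rule sum.swap)
  also have "\<dots> = (\<Sum>x\<in>S. \<Sum>y\<in>S. \<Sum>i\<in>I. c x * c y * K i x y)"
    by (intro sum.cong refl sum.swap)
  finally show ?thesis by (simp add: quad_form_def sum_distrib_left)
qed

lemma quad_form_sums:
  assumes "\<And>x y. x \<in> S \<Longrightarrow> y \<in> S \<Longrightarrow> (\<lambda>n. K n x y) sums L x y"
  shows "(\<lambda>n. quad_form (K n) S c) sums quad_form L S c"
  unfolding quad_form_def by (intro sums_sum sums_mult assms)

lemma pos_def_on_sums:
  assumes "\<And>n. pos_def_on X (K n)" and "\<And>x y. x \<in> X \<Longrightarrow> y \<in> X \<Longrightarrow> (\<lambda>n. K n x y) sums L x y"
  shows "pos_def_on X L"
proof (rule pos_def_onI)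
  fix x y assume "x \<in> X" "y \<in> X"
  then show "L x y = L y x"
    using sums_unique2[OF assms(2)[of x y]] assms(2)[of y x] pos_def_on_sym[OF assms(1), of x y]
    by simp
next
  fix S c assume S: "finite S" "S \<subseteq> X"
  have lim: "(\<lambda>n. quad_form (K n) S c) sums quad_form L S c"
    using S assms(2) by (intro quad_form_sums) blast
  have "0 \<le> quad_form (K n) S c" for n
    by (rule pos_def_on_quad_form[OF assms(1) S])
  then show "0 \<le> quad_form L S c"
    by (rule sums_le[OF _ sums_zero lim])
qed

lemma (in real_inner_space) pos_def_on_ip:
  assumes f: "f \<in> X \<rightarrow> carrier V"
  shows "pos_def_on X (\<lambda>x y. ip (f x) (f y))"
proof (rule pos_def_onI)
  show "ip (f x) (f y) = ip (f y) (f x)" if "x \<in> X" "y \<in> X" for x y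
    using f that by (intro ip_commute) auto
next
  fix S c assume S: "finite S" "S \<subseteq> X"
  then have "\<exists>v\<in>carrier V. \<forall>w\<in>carrier V. ip v w = (\<Sum>x\<in>S. c x * ip (f x) w)"
  proof (induction S rule: finite_induct)
    case empty
    then show ?case by (auto intro!: bexI[of _ "\<zero>"] simp: ip_zero_left)
  next
    case (insert z S)
    then obtain v where v: "v \<in> carrier V" "\<And>w. w \<in> carrier V \<Longrightarrow> ip v w = (\<Sum>x\<in>S. c x * ip (f x) w)"
      by auto
    have z: "f z \<in> carrier V" using insert.prems f by auto
    then show ?case
      using v insert.hyps smult_in[OF z]
      by (intro bexI[of _ "c z \<odot> f z \<oplus> v"]) (auto simp: ip_add_left ip_smult_left)
  qed
  then obtain v where v: "v \<in> carrier V" "\<And>w. w \<in> carrier V \<Longrightarrow> ip v w = (\<Sum>x\<in>S. c x * ip (f x) w)"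
    by auto
  have fx: "f x \<in> carrier V" if "x \<in> S" for x using that S f by auto
  have "c x * ip (f x) v = (\<Sum>y\<in>S. c x * c y * ip (f x) (f y))" if "x \<in> S" for x
  proof -
    have "ip (f x) v = (\<Sum>y\<in>S. c y * ip (f y) (f x))"
      using v fx[OF that] ip_commute[of "f x" v] by simp
    also have "\<dots> = (\<Sum>y\<in>S. c y * ip (f x) (f y))"
      using fx that by (intro sum.cong refl) (simp add: ip_commute)
    finally show ?thesis by (simp add: sum_distrib_left mult.assoc)
  qed
  then have "ip v v = quad_form (\<lambda>x y. ip (f x) (f y)) S c"
    using v by (simp add: quad_form_def)
  then show "0 \<le> quad_form (\<lambda>x y. ip (f x) (f y)) S c"
    using ip_nonneg[OF v(1)] by simp
qed

lemma pos_def_on_power: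
  assumes "pos_def_on X K"
  shows "pos_def_on X (\<lambda>x y. K x y ^ n)"
proof (induction n)
  case 0
  show ?case by (simp add: pos_def_on_const)
next
  case (Suc n)
  show ?case using Schur_product[OF assms Suc] by simp
qed

lemma pos_def_on_scale:
  assumes "pos_def_on X K" "0 \<le> r"
  shows "pos_def_on X (\<lambda>x y. r * K x y)"
  using Schur_product[OF pos_def_on_const[OF assms(2)] assms(1)] .

lemma pos_def_on_exp:
  assumes "pos_def_on X K"
  shows "pos_def_on X (\<lambda>x y. exp (K x y))"
proof (rule pos_def_on_sums[where K = "\<lambda>n x y. inverse (fact n) * K x y ^ n"])
  show "pos_def_on X (\<lambda>x y. inverse (fact n) * K x y ^ n)" for n
    by (rule pos_def_on_scale[OF pos_def_on_power[OF assms]]) simp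
  fix x y
  have "(\<lambda>n. inverse (fact n) *\<^sub>R K x y ^ n) sums exp (K x y)"
    by (rule exp_converges)
  then show "(\<lambda>n. inverse (fact n) * K x y ^ n) sums exp (K x y)"
    by (simp only: real_scaleR_def)
qed

text \<open>Expanding the square, the Gaussian kernel is a diagonal rescaling of the exponential of a
  multiple of the inner product.\<close>

lemma (in real_inner_space) pos_def_on_Gaussian:
  assumes f: "f \<in> X \<rightarrow> carrier V" and t: "0 \<le> t"
  shows "pos_def_on X (\<lambda>x y. exp (- t * (vnorm (f x \<ominus> f y))\<^sup>2))"
proof -
  define a where "a x = exp (- t * ip (f x) (f x))" for x
  have "pos_def_on X (\<lambda>x y. 2 * t * ip (f x) (f y))"
    by (rule pos_def_on_scale[OF pos_def_on_ip[OF f]]) (use t in simp)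
  then have *: "pos_def_on X (\<lambda>x y. a x * a y * exp (2 * t * ip (f x) (f y)))"
    by (rule pos_def_on_rescale[OF pos_def_on_exp])
  show ?thesis
  proof (rule pos_def_on_cong[OF *])
    fix x y assume "x \<in> X" "y \<in> X"
    then have xy: "f x \<in> carrier V" "f y \<in> carrier V" using f by auto
    have "(vnorm (f x \<ominus> f y))\<^sup>2 = ip (f x \<ominus> f y) (f x \<ominus> f y)"
      using xy by (simp add: vnorm_def ip_nonneg M.minus_closed)
    also have "\<dots> = ip (f x) (f x) + ip (f y) (f y) - 2 * ip (f x) (f y)"
      using xy ip_commute[OF xy] by (simp add: ip_diff_left ip_diff_right M.minus_closed)
    finally show "exp (- t * (vnorm (f x \<ominus> f y))\<^sup>2) = a x * a y * exp (2 * t * ip (f x) (f y))"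
      by (simp add: a_def exp_add[symmetric] right_diff_distrib distrib_left)
  qed
qed

section \<open>The Hilbert space of a kernel\<close>

text \<open>For finitely supported coefficients \<open>c\<close> put \<open>Q c = quad_form K S c\<close> and
  \<open>F c = \<Sum>x\<in>S. c x * F x\<close>.  The squared norm of a function \<open>F\<close> is the convex conjugate
  \<open>SUP c. 2 * F c - Q c\<close>.  This agrees with the squared dual norm of the functional
  \<open>c \<mapsto> F c\<close> for the seminorm \<open>sqrt (Q c)\<close>, and it avoids quotients and completions: degenerate
  \<open>Q\<close> are harmless, pointwise limits of Cauchy sequences stay inside the space because a
  supremum is lower semicontinuous, and the parallelogram law for \<open>Q\<close> passes to the conjugate.  The inner
  product is then recovered by polarisation, following Jordan and von Neumann.\<close>

locale reproducing_kernel =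
  fixes X :: "'a set" and K :: "'a \<Rightarrow> 'a \<Rightarrow> real"
  assumes pos_def: "pos_def_on X K"
begin

definition dual_value :: "('a \<Rightarrow> real) \<Rightarrow> 'a set \<Rightarrow> ('a \<Rightarrow> real) \<Rightarrow> real" where
  "dual_value F S c = 2 * (\<Sum>x\<in>S. c x * F x) - quad_form K S c"

definition dual_values :: "('a \<Rightarrow> real) \<Rightarrow> real set" where
  "dual_values F = {dual_value F S c | S c. finite S \<and> S \<subseteq> X}"

definition sq_norm :: "('a \<Rightarrow> real) \<Rightarrow> real" where
  "sq_norm F = Sup (dual_values F)"

definition rkhs :: "('a \<Rightarrow> real) set" where
  "rkhs = {F. (\<forall>x. x \<notin> X \<longrightarrow> F x = 0) \<and> bdd_above (dual_values F)}"

definition inner_prod :: "('a \<Rightarrow> real) \<Rightarrow> ('a \<Rightarrow> real) \<Rightarrow> real" where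
  "inner_prod F G = (sq_norm (\<lambda>x. F x + G x) - sq_norm (\<lambda>x. F x - G x)) / 4"

lemma dual_value_le:
  "F \<in> rkhs \<Longrightarrow> finite S \<Longrightarrow> S \<subseteq> X \<Longrightarrow> dual_value F S c \<le> sq_norm F"
  unfolding rkhs_def sq_norm_def by (rule cSup_upper) (auto simp: dual_values_def)

lemma sq_norm_le:
  assumes "\<And>S c. finite S \<Longrightarrow> S \<subseteq> X \<Longrightarrow> dual_value F S c \<le> M"
  shows "sq_norm F \<le> M"
  unfolding sq_norm_def
proof (rule cSup_least)
  show "dual_values F \<noteq> {}" unfolding dual_values_def by blast
qed (use assms in \<open>auto simp: dual_values_def\<close>)

lemma rkhsI:
  assumes "\<And>x. x \<notin> X \<Longrightarrow> F x = 0"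
    and "\<And>S c. finite S \<Longrightarrow> S \<subseteq> X \<Longrightarrow> dual_value F S c \<le> M"
  shows "F \<in> rkhs"
  using assms unfolding rkhs_def by (auto simp: dual_values_def intro!: bdd_aboveI[of _ M])

lemma rkhs_outside: "F \<in> rkhs \<Longrightarrow> x \<notin> X \<Longrightarrow> F x = 0"
  by (simp add: rkhs_def)

lemma sq_norm_nonneg: "F \<in> rkhs \<Longrightarrow> 0 \<le> sq_norm F"
  using dual_value_le[of F "{}"] by (simp add: dual_value_def quad_form_def)

lemma dual_value_mono_neutral:
  assumes "finite U" "S \<subseteq> U"
  shows "dual_value F U (\<lambda>x. if x \<in> S then c x else 0) = dual_value F S c"
proof -
  have "(\<Sum>x\<in>U. (if x \<in> S then c x else 0) * F x) = (\<Sum>x\<in>S. c x * F x)"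
    using assms by (intro sum.mono_neutral_cong_right) auto
  then show ?thesis
    using assms by (simp add: dual_value_def quad_form_mono_neutral)
qed

text \<open>Half of the parallelogram law is already visible before taking suprema: it comes from the
  change of variables \<open>(b, c) \<mapsto> ((b + c) / 2, (b - c) / 2)\<close> in the coefficients.\<close>

lemma dual_value_parallelogram:
  assumes F: "F \<in> rkhs" and G: "G \<in> rkhs"
    and S: "finite S" "S \<subseteq> X" and T: "finite T" "T \<subseteq> X"
  shows "dual_value (\<lambda>x. F x + G x) S b + dual_value (\<lambda>x. F x - G x) T c
       \<le> 2 * sq_norm F + 2 * sq_norm G"
proof -
  define U where "U = S \<union> T"
  define b' where "b' x = (if x \<in> S then b x else 0)" for x
  define c' where "c' x = (if x \<in> T then c x else 0)" for x
  have U: "finite U" "U \<subseteq> X" using S T by (auto simp: U_def)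
  have "dual_value (\<lambda>x. F x + G x) S b + dual_value (\<lambda>x. F x - G x) T c
      = dual_value (\<lambda>x. F x + G x) U b' + dual_value (\<lambda>x. F x - G x) U c'"
    unfolding b'_def c'_def using U by (subst (1 2) dual_value_mono_neutral) (auto simp: U_def)
  also have "\<dots> = 2 * dual_value F U (\<lambda>x. (b' x + c' x) / 2) + 2 * dual_value G U (\<lambda>x. (b' x - c' x) / 2)"
    unfolding dual_value_def quad_form_def
    by (simp add: sum_distrib_left sum.distrib[symmetric] sum_subtractf[symmetric])
       (intro sum.cong refl, simp add: sum_distrib_left sum.distrib[symmetric] sum_subtractf[symmetric]
         field_simps)
  also have "\<dots> \<le> 2 * sq_norm F + 2 * sq_norm G"
    using dual_value_le[OF F U] dual_value_le[OF G U] by (intro add_mono mult_left_mono) auto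
  finally show ?thesis .
qed

lemma rkhs_add:
  assumes "F \<in> rkhs" "G \<in> rkhs"
  shows "(\<lambda>x. F x + G x) \<in> rkhs"
proof (rule rkhsI)
  fix S c assume "finite S" "S \<subseteq> X"
  then show "dual_value (\<lambda>x. F x + G x) S c \<le> 2 * sq_norm F + 2 * sq_norm G"
    using dual_value_parallelogram[OF assms, of S "{}" c] by (simp add: dual_value_def[of _ "{}"] quad_form_def)
qed (simp add: rkhs_outside[OF assms(1)] rkhs_outside[OF assms(2)])

lemma rkhs_diff:
  assumes "F \<in> rkhs" "G \<in> rkhs"
  shows "(\<lambda>x. F x - G x) \<in> rkhs"
proof (rule rkhsI)
  fix S c assume "finite S" "S \<subseteq> X"
  then show "dual_value (\<lambda>x. F x - G x) S c \<le> 2 * sq_norm F + 2 * sq_norm G"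
    using dual_value_parallelogram[OF assms, of "{}" S _ c] by (simp add: dual_value_def[of _ "{}"] quad_form_def)
qed (simp add: rkhs_outside[OF assms(1)] rkhs_outside[OF assms(2)])

lemma dual_value_scale:
  assumes "a \<noteq> 0"
  shows "dual_value (\<lambda>x. a * F x) S c = a\<^sup>2 * dual_value F S (\<lambda>x. c x / a)"
  using assms by (simp add: dual_value_def quad_form_def sum_distrib_left right_diff_distrib power2_eq_square mult_ac)

lemma sq_norm_zero: "sq_norm (\<lambda>_. 0) = 0" and rkhs_zero: "(\<lambda>_. 0) \<in> rkhs"
proof -
  have *: "dual_value (\<lambda>_. 0) S c \<le> 0" if "finite S" "S \<subseteq> X" for S c
    using pos_def_on_quad_form[OF pos_def that] by (simp add: dual_value_def)
  show z: "(\<lambda>_. 0) \<in> rkhs" using * by (intro rkhsI) auto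
  show "sq_norm (\<lambda>_. 0) = 0"
    using sq_norm_le[of "\<lambda>_. 0" 0] * sq_norm_nonneg[OF z] by force
qed

lemma rkhs_scale:
  assumes F: "F \<in> rkhs"
  shows "(\<lambda>x. a * F x) \<in> rkhs"
proof (cases "a = 0")
  case False
  show ?thesis
  proof (rule rkhsI)
    fix S c assume "finite S" "S \<subseteq> X"
    then show "dual_value (\<lambda>x. a * F x) S c \<le> a\<^sup>2 * sq_norm F"
      using dual_value_le[OF F] by (simp add: dual_value_scale[OF False] mult_left_mono)
  qed (simp add: rkhs_outside[OF F])
qed (simp add: rkhs_zero)

lemma sq_norm_scale:
  assumes F: "F \<in> rkhs"
  shows "sq_norm (\<lambda>x. a * F x) = a\<^sup>2 * sq_norm F"
proof (cases "a = 0")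
  case False
  have le: "sq_norm (\<lambda>x. r * G x) \<le> r\<^sup>2 * sq_norm G" if "G \<in> rkhs" "r \<noteq> 0" for r G
    using dual_value_le[OF that(1)]
    by (intro sq_norm_le) (simp add: dual_value_scale[OF that(2)] mult_left_mono)
  have "sq_norm F \<le> (1 / a)\<^sup>2 * sq_norm (\<lambda>x. a * F x)"
    using le[of "\<lambda>x. a * F x" "1 / a"] False rkhs_scale[OF F] by simp
  then have "a\<^sup>2 * sq_norm F \<le> sq_norm (\<lambda>x. a * F x)"
    using False by (simp add: power_divide field_simps)
  then show ?thesis using le[OF F False] by simp
qed (simp add: sq_norm_zero)

text \<open>The second inequality is the first one applied to \<open>F + G\<close> and \<open>F - G\<close>.\<close>

lemma parallelogram:
  assumes F: "F \<in> rkhs" and G: "G \<in> rkhs"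
  shows "sq_norm (\<lambda>x. F x + G x) + sq_norm (\<lambda>x. F x - G x) = 2 * sq_norm F + 2 * sq_norm G"
proof -
  have le: "sq_norm (\<lambda>x. F x + G x) + sq_norm (\<lambda>x. F x - G x) \<le> 2 * sq_norm F + 2 * sq_norm G"
    if F: "F \<in> rkhs" and G: "G \<in> rkhs" for F G
  proof -
    have "dual_value (\<lambda>x. F x + G x) S b
        \<le> 2 * sq_norm F + 2 * sq_norm G - sq_norm (\<lambda>x. F x - G x)" if "finite S" "S \<subseteq> X" for S b
    proof -
      have "sq_norm (\<lambda>x. F x - G x) \<le> 2 * sq_norm F + 2 * sq_norm G - dual_value (\<lambda>x. F x + G x) S b"
        using dual_value_parallelogram[OF F G that] by (intro sq_norm_le) (simp add: algebra_simps)
      then show ?thesis by simp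
    qed
    then have "sq_norm (\<lambda>x. F x + G x) \<le> 2 * sq_norm F + 2 * sq_norm G - sq_norm (\<lambda>x. F x - G x)"
      by (rule sq_norm_le)
    then show ?thesis by simp
  qed
  have "4 * sq_norm F + 4 * sq_norm G
      = sq_norm (\<lambda>x. 2 * F x) + sq_norm (\<lambda>x. 2 * G x)"
    using sq_norm_scale[OF F, of 2] sq_norm_scale[OF G, of 2] by simp
  also have "\<dots> \<le> 2 * sq_norm (\<lambda>x. F x + G x) + 2 * sq_norm (\<lambda>x. F x - G x)"
    using le[OF rkhs_add[OF F G] rkhs_diff[OF F G]] by (simp add: algebra_simps)
  finally show ?thesis using le[OF F G] by simp
qed

lemma inner_prod_self: "F \<in> rkhs \<Longrightarrow> inner_prod F F = sq_norm F"
  using sq_norm_scale[of F 2] by (simp add: inner_prod_def sq_norm_zero)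

lemma sq_norm_minus: "F \<in> rkhs \<Longrightarrow> sq_norm (\<lambda>x. - F x) = sq_norm F"
  using sq_norm_scale[of F "- 1"] by simp

lemma inner_prod_commute:
  assumes "F \<in> rkhs" "G \<in> rkhs"
  shows "inner_prod F G = inner_prod G F"
  using sq_norm_minus[OF rkhs_diff[OF assms]] by (simp add: inner_prod_def add.commute)

lemma inner_prod_zero_left: "G \<in> rkhs \<Longrightarrow> inner_prod (\<lambda>_. 0) G = 0"
  using sq_norm_minus[of G] by (simp add: inner_prod_def)

text \<open>The parallelogram law for the pairs \<open>(F + E, G)\<close> and \<open>(F - E, G)\<close>, subtracted from each
  other.\<close>

lemma inner_prod_add_diff:
  assumes F: "F \<in> rkhs" and G: "G \<in> rkhs" and E: "E \<in> rkhs"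
  shows "inner_prod (\<lambda>x. F x + G x) E + inner_prod (\<lambda>x. F x - G x) E = 2 * inner_prod F E"
  using parallelogram[OF rkhs_add[OF F E] G] parallelogram[OF rkhs_diff[OF F E] G]
  by (simp add: inner_prod_def field_simps)

lemma inner_prod_add_left:
  assumes F: "F \<in> rkhs" and G: "G \<in> rkhs" and E: "E \<in> rkhs"
  shows "inner_prod (\<lambda>x. F x + G x) E = inner_prod F E + inner_prod G E"
proof -
  have double: "inner_prod (\<lambda>x. 2 * H x) E = 2 * inner_prod H E" if "H \<in> rkhs" for H
    using inner_prod_add_diff[OF that that E] inner_prod_zero_left[OF E] by simp
  define P where "P = (\<lambda>x. (1/2) * (F x + G x))"
  define Q where "Q = (\<lambda>x. (1/2) * (F x - G x))"
  have PQ: "P \<in> rkhs" "Q \<in> rkhs"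
    unfolding P_def Q_def
    by (rule rkhs_scale[OF rkhs_add[OF F G]], rule rkhs_scale[OF rkhs_diff[OF F G]])
  have "inner_prod F E + inner_prod G E = 2 * inner_prod P E"
    using inner_prod_add_diff[OF PQ E] by (simp add: P_def Q_def field_simps)
  also have "\<dots> = inner_prod (\<lambda>x. F x + G x) E"
    using double[OF PQ(1)] by (simp add: P_def add_divide_distrib)
  finally show ?thesis by simp
qed

end

text \<open>Subtracting \<open>x * g 1\<close> leaves an additive function of period 1, hence bounded on the whole
  line, and a bounded additive function vanishes.\<close>

lemma bounded_additive_linear:
  fixes g :: "real \<Rightarrow> real"
  assumes add: "\<And>x y. g (x + y) = g x + g y"
    and bdd: "\<And>x. 0 \<le> x \<Longrightarrow> x \<le> 1 \<Longrightarrow> \<bar>g x\<bar> \<le> M"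
  shows "g x = x * g 1"
proof -
  define h where "h x = g x - x * g 1" for x
  have hadd: "h (x + y) = h x + h y" for x y
    by (simp add: h_def add algebra_simps)
  have h0: "h 0 = 0" using hadd[of 0 0] by simp
  have hneg: "h (- x) = - h x" for x using hadd[of x "- x"] h0 by simp
  have hnat: "h (real n * x) = real n * h x" for n x
    by (induction n) (auto simp: h0 hadd algebra_simps)
  have h1: "h 1 = 0" by (simp add: h_def)
  have hint: "h (of_int k) = 0" for k
  proof (cases "0 \<le> k")
    case True
    then show ?thesis using hnat[of "nat k" 1] h1 by simp
  next
    case False
    then show ?thesis using hnat[of "nat (- k)" 1] h1 hneg[of "of_int k"] by simp
  qed
  have hb: "\<bar>h y\<bar> \<le> M + \<bar>g 1\<bar>" for y
  proof -
    have "h y = h (frac y)"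
      using hadd[of "frac y" "of_int \<lfloor>y\<rfloor>"] hint by (simp add: frac_def)
    moreover have "\<bar>h (frac y)\<bar> \<le> M + \<bar>g 1\<bar>"
    proof -
      have f: "0 \<le> frac y" "frac y \<le> 1" by (auto intro: less_imp_le frac_lt_1)
      have "\<bar>frac y * g 1\<bar> \<le> 1 * \<bar>g 1\<bar>"
        unfolding abs_mult using f by (intro mult_right_mono) auto
      then show ?thesis using bdd[OF f] unfolding h_def by linarith
    qed
    ultimately show ?thesis by simp
  qed
  have "h x = 0"
  proof (rule ccontr)
    assume "h x \<noteq> 0"
    then obtain n :: nat where "M + \<bar>g 1\<bar> < real n * \<bar>h x\<bar>"
      using reals_Archimedean3[of "\<bar>h x\<bar>"] by auto
    then show False using hb[of "real n * x"] by (simp add: hnat abs_mult)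
  qed
  then show ?thesis by (simp add: h_def)
qed

context reproducing_kernel
begin

lemma inner_prod_scale_left:
  assumes F: "F \<in> rkhs" and G: "G \<in> rkhs"
  shows "inner_prod (\<lambda>x. a * F x) G = a * inner_prod F G"
proof -
  define g where "g a = inner_prod (\<lambda>x. a * F x) G" for a
  have "g a = a * g 1"
  proof (rule bounded_additive_linear)
    show "g (a + b) = g a + g b" for a b
      using inner_prod_add_left[OF rkhs_scale[OF F] rkhs_scale[OF F] G]
      by (simp add: g_def distrib_right)
  next
    fix a :: real assume a: "0 \<le> a" "a \<le> 1"
    have aF: "(\<lambda>x. a * F x) \<in> rkhs" by (rule rkhs_scale[OF F])
    have "sq_norm (\<lambda>x. a * F x) \<le> sq_norm F"
      using a sq_norm_nonneg[OF F] by (simp add: sq_norm_scale[OF F] mult_left_le_one_le power_le_one)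
    then have "sq_norm (\<lambda>x. a * F x + G x) + sq_norm (\<lambda>x. a * F x - G x) \<le> 2 * (sq_norm F + sq_norm G)"
      using parallelogram[OF aF G] by simp
    then have "\<bar>sq_norm (\<lambda>x. a * F x + G x) - sq_norm (\<lambda>x. a * F x - G x)\<bar> \<le> 2 * (sq_norm F + sq_norm G)"
      using sq_norm_nonneg[OF rkhs_add[OF aF G]] sq_norm_nonneg[OF rkhs_diff[OF aF G]] by simp
    then show "\<bar>g a\<bar> \<le> (sq_norm F + sq_norm G) / 2"
      by (simp add: g_def inner_prod_def)
  qed
  then show ?thesis by (simp add: g_def)
qed

text \<open>Evaluations are bounded: test the supremum on a multiple of the point mass.  The summand
  \<open>1\<close> covers the points with \<open>K x x = 0\<close>.\<close>

lemma evaluation_bound: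
  assumes F: "F \<in> rkhs" and x: "x \<in> X"
  shows "(F x)\<^sup>2 \<le> (K x x + 1) * sq_norm F"
proof -
  define k where "k = K x x + 1"
  have k: "k > 0" using pos_def_on_diag[OF pos_def x] by (simp add: k_def)
  have Kxx: "K x x = k - 1" by (simp add: k_def)
  have "(F x)\<^sup>2 / k \<le> (F x)\<^sup>2 / k + (F x)\<^sup>2 / k\<^sup>2" by simp
  also have "\<dots> = dual_value F {x} (\<lambda>_. F x / k)"
    using k by (simp add: dual_value_def quad_form_def Kxx field_simps power2_eq_square)
  also have "\<dots> \<le> sq_norm F" by (rule dual_value_le[OF F]) (use x in auto)
  finally show ?thesis using k by (simp add: k_def field_simps)
qed

definition hilbert :: "(real, 'a \<Rightarrow> real) module" where
  "hilbert = \<lparr>carrier = rkhs, mult = undefined, one = undefined,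
     zero = (\<lambda>x. 0), add = (\<lambda>F G x. F x + G x), smult = (\<lambda>a F x. a * F x)\<rparr>"

lemma hilbert_simps:
  "carrier hilbert = rkhs" "\<zero>\<^bsub>hilbert\<^esub> = (\<lambda>x. 0)"
  "F \<oplus>\<^bsub>hilbert\<^esub> G = (\<lambda>x. F x + G x)" "a \<odot>\<^bsub>hilbert\<^esub> F = (\<lambda>x. a * F x)"
  by (simp_all add: hilbert_def)

lemma abelian_group_hilbert: "abelian_group hilbert"
proof (rule abelian_groupI)
  show "\<exists>G\<in>carrier hilbert. G \<oplus>\<^bsub>hilbert\<^esub> F = \<zero>\<^bsub>hilbert\<^esub>" if "F \<in> carrier hilbert" for F
    using rkhs_scale[of F "- 1"] that
    by (intro bexI[of _ "\<lambda>x. - F x"]) (auto simp: hilbert_simps)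
qed (auto simp: hilbert_simps rkhs_add rkhs_zero algebra_simps)

lemma sq_norm_eq_0_iff: "F \<in> rkhs \<Longrightarrow> sq_norm F = 0 \<longleftrightarrow> F = (\<lambda>_. 0)"
proof
  assume F: "F \<in> rkhs" "sq_norm F = 0"
  show "F = (\<lambda>_. 0)"
  proof
    fix x show "F x = 0"
      using evaluation_bound[OF F(1), of x] rkhs_outside[OF F(1), of x] F(2) by (cases "x \<in> X") auto
  qed
qed (simp add: sq_norm_zero)

sublocale inner_space: real_inner_space hilbert inner_prod
proof -
  interpret A: abelian_group hilbert by (rule abelian_group_hilbert)
  interpret R: cring real_ring by (rule cring_real_ring)
  show "real_inner_space hilbert inner_prod"
  proof (unfold_locales, goal_cases)
    case (1 a F)
    then show ?case by (simp add: hilbert_simps rkhs_scale)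
  next
    case (6 F G)
    then show ?case unfolding hilbert_simps by (rule inner_prod_commute)
  next
    case (7 F G E)
    then show ?case unfolding hilbert_simps by (rule inner_prod_add_left)
  next
    case (8 F G a)
    then show ?case unfolding hilbert_simps by (rule inner_prod_scale_left)
  next
    case (9 F)
    then show ?case by (simp add: hilbert_simps inner_prod_self sq_norm_nonneg)
  next
    case (10 F)
    then show ?case by (simp add: hilbert_simps inner_prod_self sq_norm_eq_0_iff)
  qed (auto simp: hilbert_simps real_ring_def algebra_simps)
qed

lemma minus_hilbert:
  assumes "F \<in> rkhs" "G \<in> rkhs"
  shows "F \<ominus>\<^bsub>hilbert\<^esub> G = (\<lambda>x. F x - G x)"
proof -
  have "(\<lambda>x. - G x) \<in> rkhs" using rkhs_scale[OF assms(2), of "- 1"] by simp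
  then have "\<ominus>\<^bsub>hilbert\<^esub> G = (\<lambda>x. - G x)"
    using assms by (intro inner_space.M.minus_equality) (auto simp: hilbert_simps)
  then show ?thesis by (simp add: a_minus_def hilbert_simps)
qed

lemma vnorm_hilbert: "F \<in> rkhs \<Longrightarrow> inner_space.vnorm F = sqrt (sq_norm F)"
  by (simp add: inner_space.vnorm_def inner_prod_self)

text \<open>Cauchy sequences converge pointwise, since evaluations are bounded.  Each single dual value is
  continuous under pointwise convergence, so the Cauchy estimate survives in the limit for every
  dual value and hence for their supremum.\<close>

lemma Cauchy_hilbert_limit:
  fixes \<sigma> :: "nat \<Rightarrow> 'a \<Rightarrow> real"
  assumes \<sigma>: "\<And>n. \<sigma> n \<in> rkhs"
    and cau: "\<And>e. 0 < e \<Longrightarrow> \<exists>N. \<forall>m\<ge>N. \<forall>n\<ge>N. sq_norm (\<lambda>x. \<sigma> m x - \<sigma> n x) < e"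
  obtains F where "F \<in> rkhs"
    "\<And>e. 0 < e \<Longrightarrow> \<exists>N. \<forall>m\<ge>N. sq_norm (\<lambda>x. \<sigma> m x - F x) \<le> e"
proof -
  have "Cauchy (\<lambda>n. \<sigma> n x)" for x
  proof (cases "x \<in> X")
    case True
    then have k: "K x x + 1 > 0" using pos_def_on_diag[OF pos_def True] by simp
    show ?thesis
    proof (rule CauchyI)
      fix e :: real assume e: "0 < e"
      then obtain N where N: "\<And>m n. m \<ge> N \<Longrightarrow> n \<ge> N \<Longrightarrow> sq_norm (\<lambda>x. \<sigma> m x - \<sigma> n x) < e\<^sup>2 / (K x x + 1)"
        using cau[of "e\<^sup>2 / (K x x + 1)"] k by auto
      have "norm (\<sigma> m x - \<sigma> n x) < e" if "m \<ge> N" "n \<ge> N" for m n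
      proof -
        have "(\<sigma> m x - \<sigma> n x)\<^sup>2 \<le> (K x x + 1) * sq_norm (\<lambda>x. \<sigma> m x - \<sigma> n x)"
          using evaluation_bound[OF rkhs_diff[OF \<sigma> \<sigma>] True] by simp
        also have "\<dots> < e\<^sup>2" using N[OF that] k by (simp add: field_simps)
        finally show ?thesis using e abs_le_square_iff[of e "\<sigma> m x - \<sigma> n x"] by simp
      qed
      then show "\<exists>N. \<forall>m\<ge>N. \<forall>n\<ge>N. norm (\<sigma> m x - \<sigma> n x) < e" by blast
    qed
  next
    case False
    then show ?thesis using rkhs_outside[OF \<sigma> False] by (simp add: Cauchy_def)
  qed
  then have "\<forall>x. \<exists>l. (\<lambda>n. \<sigma> n x) \<longlonglongrightarrow> l"
    using Cauchy_convergent convergent_def by blast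
  then obtain F where F: "\<And>x. (\<lambda>n. \<sigma> n x) \<longlonglongrightarrow> F x" by metis
  have close: "dual_value (\<lambda>x. \<sigma> m x - F x) S c \<le> e"
    if N: "\<And>m n. m \<ge> N \<Longrightarrow> n \<ge> N \<Longrightarrow> sq_norm (\<lambda>x. \<sigma> m x - \<sigma> n x) < e" and "m \<ge> N" "finite S" "S \<subseteq> X"
    for e N m S c
  proof (rule LIMSEQ_le_const2)
    show "(\<lambda>n. dual_value (\<lambda>x. \<sigma> m x - \<sigma> n x) S c) \<longlonglongrightarrow> dual_value (\<lambda>x. \<sigma> m x - F x) S c"
      unfolding dual_value_def by (intro tendsto_intros F)
    have "dual_value (\<lambda>x. \<sigma> m x - \<sigma> n x) S c \<le> e" if "n \<ge> N" for n
      using dual_value_le[OF rkhs_diff[OF \<sigma> \<sigma>] \<open>finite S\<close> \<open>S \<subseteq> X\<close>, of m n c] N[OF \<open>m \<ge> N\<close> that]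
      by linarith
    then show "\<exists>N. \<forall>n\<ge>N. dual_value (\<lambda>x. \<sigma> m x - \<sigma> n x) S c \<le> e" by blast
  qed
  have outside: "F x = 0" if "x \<notin> X" for x
    using F[of x] rkhs_outside[OF \<sigma> that] LIMSEQ_unique[OF _ tendsto_const] by auto
  obtain N where N: "\<And>m n. m \<ge> N \<Longrightarrow> n \<ge> N \<Longrightarrow> sq_norm (\<lambda>x. \<sigma> m x - \<sigma> n x) < 1"
    using cau[of 1] by auto
  have "(\<lambda>x. \<sigma> N x - F x) \<in> rkhs"
    using close[OF N] outside rkhs_outside[OF \<sigma>] by (intro rkhsI[where M = 1]) auto
  from rkhs_diff[OF \<sigma>[of N] this] have "F \<in> rkhs" by simp
  moreover have "\<exists>N. \<forall>m\<ge>N. sq_norm (\<lambda>x. \<sigma> m x - F x) \<le> e" if "0 < e" for e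
  proof -
    obtain N where "\<And>m n. m \<ge> N \<Longrightarrow> n \<ge> N \<Longrightarrow> sq_norm (\<lambda>x. \<sigma> m x - \<sigma> n x) < e"
      using cau[OF \<open>0 < e\<close>] by auto
    from close[OF this] show ?thesis by (intro exI[of _ N] allI impI sq_norm_le) auto
  qed
  ultimately show thesis by (rule that)
qed

lemma hilbert_space_hilbert: "hilbert_space hilbert inner_prod"
proof
  fix \<sigma> :: "nat \<Rightarrow> 'a \<Rightarrow> real"
  assume "\<And>n. \<sigma> n \<in> carrier hilbert"
    and cau: "\<forall>e>0. \<exists>N. \<forall>m\<ge>N. \<forall>n\<ge>N. inner_space.vnorm (\<sigma> m \<ominus>\<^bsub>hilbert\<^esub> \<sigma> n) < e"
  then have \<sigma>: "\<sigma> n \<in> rkhs" for n by (simp add: hilbert_simps)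
  have dist: "inner_space.vnorm (\<sigma> m \<ominus>\<^bsub>hilbert\<^esub> G) = sqrt (sq_norm (\<lambda>x. \<sigma> m x - G x))" if "G \<in> rkhs" for m G
    using that \<sigma> by (simp add: minus_hilbert vnorm_hilbert rkhs_diff)
  have "\<exists>N. \<forall>m\<ge>N. \<forall>n\<ge>N. sq_norm (\<lambda>x. \<sigma> m x - \<sigma> n x) < e" if "0 < e" for e
    using cau[rule_format, of "sqrt e"] that by (simp add: dist[OF \<sigma>])
  then obtain F where F: "F \<in> rkhs"
    and lim: "\<And>e. 0 < e \<Longrightarrow> \<exists>N. \<forall>m\<ge>N. sq_norm (\<lambda>x. \<sigma> m x - F x) \<le> e"
    using Cauchy_hilbert_limit[of \<sigma>] \<sigma> by metis
  have "(\<lambda>n. inner_space.vnorm (\<sigma> n \<ominus>\<^bsub>hilbert\<^esub> F)) \<longlonglongrightarrow> 0"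
  proof (rule LIMSEQ_I)
    fix r :: real assume r: "0 < r"
    obtain N where N: "\<And>m. m \<ge> N \<Longrightarrow> sq_norm (\<lambda>x. \<sigma> m x - F x) \<le> (r / 2)\<^sup>2"
      using lim[of "(r / 2)\<^sup>2"] r by auto
    have "norm (inner_space.vnorm (\<sigma> m \<ominus>\<^bsub>hilbert\<^esub> F) - 0) < r" if "m \<ge> N" for m
    proof -
      have "sqrt (sq_norm (\<lambda>x. \<sigma> m x - F x)) \<le> r / 2"
        using N[OF that] r by (intro real_le_lsqrt) (auto simp: sq_norm_nonneg rkhs_diff \<sigma> F)
      then show ?thesis
        using r sq_norm_nonneg[OF rkhs_diff[OF \<sigma> F]] by (simp add: dist[OF F])
    qed
    then show "\<exists>N. \<forall>n\<ge>N. norm (inner_space.vnorm (\<sigma> n \<ominus>\<^bsub>hilbert\<^esub> F) - 0) < r" by blast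
  qed
  then show "\<exists>G\<in>carrier hilbert. (\<lambda>n. inner_space.vnorm (\<sigma> n \<ominus>\<^bsub>hilbert\<^esub> G)) \<longlonglongrightarrow> 0"
    using F by (auto simp: hilbert_simps)
qed

definition potential :: "'a set \<Rightarrow> ('a \<Rightarrow> real) \<Rightarrow> 'a \<Rightarrow> real" where
  "potential U e z = (if z \<in> X then \<Sum>w\<in>U. e w * K z w else 0)"

text \<open>Completing the square: on coefficients supported in \<open>U\<close> the dual value of the potential of
  \<open>e\<close> at \<open>c\<close> is \<open>quad_form K U e - quad_form K U (c - e)\<close>, which is largest for \<open>c = e\<close>.\<close>

lemma dual_value_potential:
  assumes U: "finite U" "U \<subseteq> X"
  shows "dual_value (potential U e) U c = quad_form K U e - quad_form K U (\<lambda>z. c z - e z)"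
proof -
  have 1: "(\<Sum>z\<in>U. c z * potential U e z) = (\<Sum>z\<in>U. \<Sum>w\<in>U. c z * e w * K z w)"
    using U(2) by (intro sum.cong) (auto simp: potential_def sum_distrib_left mult_ac)
  have "(\<Sum>z\<in>U. \<Sum>w\<in>U. e z * c w * K z w) = (\<Sum>w\<in>U. \<Sum>z\<in>U. e z * c w * K z w)"
    by (rule sum.swap)
  also have "\<dots> = (\<Sum>w\<in>U. \<Sum>z\<in>U. c w * e z * K w z)"
  proof (intro sum.cong refl)
    fix w z assume "w \<in> U" "z \<in> U"
    then show "e z * c w * K z w = c w * e z * K w z"
      using U(2) pos_def_on_sym[OF pos_def, of z w] by auto
  qed
  finally have 2: "(\<Sum>z\<in>U. \<Sum>w\<in>U. e z * c w * K z w) = (\<Sum>z\<in>U. \<Sum>w\<in>U. c z * e w * K z w)" .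
  have "quad_form K U (\<lambda>z. c z - e z)
      = quad_form K U c - 2 * (\<Sum>z\<in>U. \<Sum>w\<in>U. c z * e w * K z w) + quad_form K U e"
    using 2 unfolding quad_form_def by (simp add: algebra_simps sum_subtractf sum.distrib)
  then show ?thesis by (simp add: dual_value_def 1)
qed

lemma potential_rkhs: "finite U \<Longrightarrow> U \<subseteq> X \<Longrightarrow> potential U e \<in> rkhs"
  and sq_norm_potential: "finite U \<Longrightarrow> U \<subseteq> X \<Longrightarrow> sq_norm (potential U e) = quad_form K U e"
proof -
  assume U: "finite U" "U \<subseteq> X"
  have le: "dual_value (potential U e) S c \<le> quad_form K U e" if S: "finite S" "S \<subseteq> X" for S c
  proof -
    let ?e = "\<lambda>x. if x \<in> U then e x else 0" and ?c = "\<lambda>x. if x \<in> S then c x else 0"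
    have W: "finite (S \<union> U)" "S \<union> U \<subseteq> X" using U S by auto
    have "potential U e = potential (S \<union> U) ?e"
      unfolding potential_def using W by (intro ext if_cong refl sum.mono_neutral_cong_left) auto
    then have "dual_value (potential U e) S c = dual_value (potential (S \<union> U) ?e) (S \<union> U) ?c"
      using W by (simp add: dual_value_mono_neutral)
    also have "\<dots> \<le> quad_form K (S \<union> U) ?e"
      using pos_def_on_quad_form[OF pos_def W] by (simp add: dual_value_potential[OF W])
    also have "\<dots> = quad_form K U e" using W by (simp add: quad_form_mono_neutral)
    finally show ?thesis .
  qed
  show P: "potential U e \<in> rkhs" using le by (intro rkhsI) (auto simp: potential_def)
  have "quad_form K U e = dual_value (potential U e) U e"
    unfolding dual_value_potential[OF U] by (simp add: quad_form_def)
  also have "\<dots> \<le> sq_norm (potential U e)" by (rule dual_value_le[OF P U])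
  finally show "sq_norm (potential U e) = quad_form K U e"
    using sq_norm_le[OF le] by simp
qed

end

text \<open>A point \<open>x\<close> is sent to the function \<open>K _ x\<close>, which is the potential of the point mass at
  \<open>x\<close>.\<close>

theorem pos_def_kernel_embedding:
  fixes X :: "'a set"
  assumes K: "pos_def_on X K"
  obtains V :: "(real, 'a \<Rightarrow> real) module" and ip and f :: "'a \<Rightarrow> 'a \<Rightarrow> real"
  where "hilbert_space V ip" and "f \<in> X \<rightarrow> carrier V"
    and "\<And>x y. x \<in> X \<Longrightarrow> y \<in> X \<Longrightarrow>
      (real_inner_space.vnorm ip (f x \<ominus>\<^bsub>V\<^esub> f y))\<^sup>2 = K x x + K y y - 2 * K x y"
proof -
  interpret reproducing_kernel X K by unfold_locales (rule K)
  define f where "f x = potential {x} (\<lambda>_. 1)" for x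
  have f: "f x \<in> rkhs" if "x \<in> X" for x
    unfolding f_def using that by (intro potential_rkhs) auto
  show thesis
  proof (rule that)
    show "hilbert_space hilbert inner_prod" by (rule hilbert_space_hilbert)
    show "f \<in> X \<rightarrow> carrier hilbert" using f by (simp add: hilbert_simps)
  next
    fix x y assume xy: "x \<in> X" "y \<in> X"
    define e :: "'a \<Rightarrow> real" where "e z = of_bool (z = x) - of_bool (z = y)" for z
    have "(\<lambda>z. f x z - f y z) = potential {x, y} e"
      by (cases "x = y") (auto simp: f_def potential_def e_def)
    then have "sq_norm (\<lambda>z. f x z - f y z) = quad_form K {x, y} e"
      using xy by (simp add: sq_norm_potential)
    also have "\<dots> = K x x + K y y - 2 * K x y"
      using pos_def_on_sym[OF K xy] by (cases "x = y") (auto simp: quad_form_def e_def)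
    finally show "(inner_space.vnorm (f x \<ominus>\<^bsub>hilbert\<^esub> f y))\<^sup>2 = K x x + K y y - 2 * K x y"
      using sq_norm_nonneg[OF rkhs_diff[OF f[OF xy(1)] f[OF xy(2)]]] f xy
      by (simp add: minus_hilbert vnorm_hilbert rkhs_diff)
  qed
qed

section \<open>Conditionally negative definite kernels\<close>

text \<open>This is what remains of positivity when inner products are replaced by squared distances:
  for coefficients of sum zero, \<open>\<Sum>\<^sub>x\<Sum>\<^sub>y c x * c y * \<parallel>f x - f y\<parallel>\<^sup>2\<close> is minus twice the
  squared norm of \<open>\<Sum>\<^sub>x c x * f x\<close>.\<close>

definition cond_neg_def_on :: "'a set \<Rightarrow> ('a \<Rightarrow> 'a \<Rightarrow> real) \<Rightarrow> bool" where
  "cond_neg_def_on X \<Psi> \<longleftrightarrow>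
     (\<forall>x\<in>X. \<Psi> x x = 0) \<and> (\<forall>x\<in>X. \<forall>y\<in>X. \<Psi> x y = \<Psi> y x) \<and>
     (\<forall>S c. finite S \<longrightarrow> S \<subseteq> X \<longrightarrow> sum c S = 0 \<longrightarrow> quad_form \<Psi> S c \<le> 0)"

text \<open>If \<open>\<Psi> x y = \<parallel>f x - f y\<parallel>\<^sup>2\<close>, the kernel below is the inner product of \<open>f x - f p\<close> and
  \<open>f y - f p\<close>; it can be written down before \<open>f\<close> is known.\<close>

lemma cond_neg_def_on_base_point:
  assumes \<Psi>: "cond_neg_def_on X \<Psi>" and p: "p \<in> X"
  shows "pos_def_on X (\<lambda>x y. (\<Psi> x p + \<Psi> y p - \<Psi> x y) / 2)"
proof -
  define K where "K x y = (\<Psi> x p + \<Psi> y p - \<Psi> x y) / 2" for x y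
  have "pos_def_on X K"
  proof (rule pos_def_onI)
    have sym: "\<Psi> x y = \<Psi> y x" if "x \<in> X" "y \<in> X" for x y
      using \<Psi> that by (simp add: cond_neg_def_on_def)
    show "K x y = K y x" if "x \<in> X" "y \<in> X" for x y
      using sym[OF that] by (simp add: K_def)
    fix S and c :: "'a \<Rightarrow> real" assume S: "finite S" "S \<subseteq> X"
    \<comment> \<open>The row of \<open>p\<close> vanishes, so the coefficient at \<open>p\<close> is free to make the sum zero.\<close>
    define U where "U = insert p S"
    define r where "r = (\<Sum>x\<in>S - {p}. c x)"
    define b where "b x = (if x = p then - r else c x)" for x
    have U: "finite U" "U \<subseteq> X" using S p by (auto simp: U_def)
    have sum_b: "sum b U = 0"
    proof -
      have "sum b U = b p + sum b (S - {p})"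
        unfolding U_def using S(1) by (rule sum.insert_remove)
      also have "sum b (S - {p}) = r" unfolding r_def by (intro sum.cong) (auto simp: b_def)
      finally show ?thesis by (simp add: b_def)
    qed
    have Kp: "K x p = 0" "K p x = 0" if "x \<in> X" for x
      using \<Psi> p that by (auto simp: cond_neg_def_on_def K_def)
    have "quad_form K S c = quad_form K S b"
      unfolding quad_form_def
    proof (intro sum.cong refl)
      fix x y assume "x \<in> S" "y \<in> S"
      then have "x \<in> X" "y \<in> X" using S by auto
      then show "c x * c y * K x y = b x * b y * K x y"
        using Kp[of x] Kp[of y] by (cases "x = p"; cases "y = p") (simp_all add: b_def)
    qed
    also have "\<dots> = quad_form K U b"
    proof (cases "p \<in> S")
      case True
      then show ?thesis by (simp add: U_def insert_absorb)
    next
      case False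
      have row: "K x p = 0" "K p x = 0" if "x \<in> insert p S" for x
        using Kp[of x] that S p by blast+
      have "(\<Sum>x\<in>S. b x * K x p) = 0"
        using row by (intro sum.neutral) simp
      then show ?thesis
        unfolding U_def using S(1) False row
        by (subst quad_form_insert) simp_all
    qed
    also have "\<dots> = - quad_form \<Psi> U b / 2"
    proof -
      have 1: "(\<Sum>x\<in>U. \<Sum>y\<in>U. b x * \<Psi> x p * b y) = 0"
        unfolding sum_product[symmetric] sum_b by simp
      have 2: "(\<Sum>x\<in>U. \<Sum>y\<in>U. b x * (b y * \<Psi> y p)) = 0"
        unfolding sum_product[symmetric] sum_b by simp
      have "quad_form K U b = ((\<Sum>x\<in>U. \<Sum>y\<in>U. b x * \<Psi> x p * b y)
          + (\<Sum>x\<in>U. \<Sum>y\<in>U. b x * (b y * \<Psi> y p)) - quad_form \<Psi> U b) / 2"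
        unfolding quad_form_def K_def sum.distrib[symmetric] sum_subtractf[symmetric] sum_divide_distrib
        by (intro sum.cong refl) (simp add: field_simps)
      then show ?thesis unfolding 1 2 by simp
    qed
    also have "0 \<le> \<dots>"
      using \<Psi> U sum_b by (auto simp: cond_neg_def_on_def)
    finally show "0 \<le> quad_form K S c" .
  qed
  then show ?thesis by (simp add: K_def[abs_def])
qed

theorem cond_neg_def_embedding:
  fixes X :: "'a set"
  assumes \<Psi>: "cond_neg_def_on X \<Psi>" and ne: "X \<noteq> {}"
  obtains V :: "(real, 'a \<Rightarrow> real) module" and ip and f :: "'a \<Rightarrow> 'a \<Rightarrow> real"
  where "hilbert_space V ip" and "f \<in> X \<rightarrow> carrier V"
    and "\<And>x y. x \<in> X \<Longrightarrow> y \<in> X \<Longrightarrow> (real_inner_space.vnorm ip (f x \<ominus>\<^bsub>V\<^esub> f y))\<^sup>2 = \<Psi> x y"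
proof -
  obtain p where p: "p \<in> X" using ne by auto
  show thesis
  proof (rule pos_def_kernel_embedding[OF cond_neg_def_on_base_point[OF \<Psi> p]])
    fix V :: "(real, 'a \<Rightarrow> real) module" and ip and f :: "'a \<Rightarrow> 'a \<Rightarrow> real"
    assume V: "hilbert_space V ip" "f \<in> X \<rightarrow> carrier V"
      and d: "\<And>x y. x \<in> X \<Longrightarrow> y \<in> X \<Longrightarrow> (real_inner_space.vnorm ip (f x \<ominus>\<^bsub>V\<^esub> f y))\<^sup>2
        = (\<Psi> x p + \<Psi> x p - \<Psi> x x) / 2 + (\<Psi> y p + \<Psi> y p - \<Psi> y y) / 2
          - 2 * ((\<Psi> x p + \<Psi> y p - \<Psi> x y) / 2)"
    show thesis
      by (rule that[OF V]) (use d \<Psi> in \<open>auto simp: cond_neg_def_on_def field_simps\<close>)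
  qed
qed

text \<open>Normalised positive definite kernels are Gram matrices of unit vectors, and half the squared
  distance of two unit vectors is one minus their inner product.\<close>

lemma cond_neg_def_on_weighted_sums:
  assumes k: "\<And>n. pos_def_on X (k n)" and diag: "\<And>n x. x \<in> X \<Longrightarrow> k n x x = 1"
    and w: "\<And>n. 0 \<le> w n"
    and sums: "\<And>x y. x \<in> X \<Longrightarrow> y \<in> X \<Longrightarrow> (\<lambda>n. w n * (1 - k n x y)) sums \<Psi> x y"
  shows "cond_neg_def_on X \<Psi>"
  unfolding cond_neg_def_on_def
proof (intro conjI ballI allI impI)
  fix x assume "x \<in> X"
  then have "(\<lambda>n. 0) sums \<Psi> x x" using sums[of x x] by (simp add: diag)
  then show "\<Psi> x x = 0" using sums_unique2[OF _ sums_zero] by blast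
next
  fix x y assume xy: "x \<in> X" "y \<in> X"
  have "(\<lambda>n. w n * (1 - k n x y)) = (\<lambda>n. w n * (1 - k n y x))"
    using pos_def_on_sym[OF k xy] by simp
  then have "(\<lambda>n. w n * (1 - k n x y)) sums \<Psi> y x" using sums[OF xy(2,1)] by simp
  then show "\<Psi> x y = \<Psi> y x" by (rule sums_unique2[OF sums[OF xy]])
next
  fix S and c :: "'a \<Rightarrow> real" assume S: "finite S" "S \<subseteq> X" and c: "sum c S = 0"
  have lim: "(\<lambda>n. quad_form (\<lambda>x y. w n * (1 - k n x y)) S c) sums quad_form \<Psi> S c"
    using S(2) sums by (intro quad_form_sums) blast
  have "quad_form (\<lambda>x y. w n * (1 - k n x y)) S c \<le> 0" for n
  proof -
    have "quad_form (\<lambda>x y. w n * (1 - k n x y)) S c = w n * ((sum c S)\<^sup>2 - quad_form (k n) S c)"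
      unfolding quad_form_def power2_eq_square sum_product
      by (simp add: sum_subtractf sum_distrib_left right_diff_distrib mult_ac)
    also have "\<dots> \<le> 0"
      using pos_def_on_quad_form[OF k S] w c by simp
    finally show ?thesis .
  qed
  then show "quad_form \<Psi> S c \<le> 0" by (rule sums_le[OF _ lim sums_zero])
qed

section \<open>Slowly varying weights on a group of polynomial growth\<close>

text \<open>The rate \<open>e\<close> varies in the induction: half of it pays for the factor \<open>x\<close>.\<close>

lemma poly_le_exp:
  fixes P :: "real poly"
  assumes "0 < e"
  shows "\<exists>K\<ge>0. \<forall>x\<ge>0. \<bar>poly P x\<bar> \<le> K * exp (e * x)"
  using assms
proof (induction P arbitrary: e)
  case 0
  show ?case by (intro exI[of _ 0]) simp
next
  case (pCons a P)
  obtain K where K: "K \<ge> 0" "\<And>x. 0 \<le> x \<Longrightarrow> \<bar>poly P x\<bar> \<le> K * exp (e / 2 * x)"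
    using pCons.IH[of "e / 2"] pCons.prems by auto
  have "\<bar>poly (pCons a P) x\<bar> \<le> (\<bar>a\<bar> + 2 * K / e) * exp (e * x)" if x: "0 \<le> x" for x
  proof -
    have "x \<le> 2 / e * exp (e / 2 * x)"
      using exp_ge_add_one_self[of "e / 2 * x"] pCons.prems by (simp add: field_simps)
    then have "x * \<bar>poly P x\<bar> \<le> (2 / e * exp (e / 2 * x)) * (K * exp (e / 2 * x))"
      using K x pCons.prems by (intro mult_mono) auto
    also have "\<dots> = 2 * K / e * exp (e * x)"
      by (simp add: mult_exp_exp)
    finally have 1: "x * \<bar>poly P x\<bar> \<le> 2 * K / e * exp (e * x)" .
    have "\<bar>a\<bar> * 1 \<le> \<bar>a\<bar> * exp (e * x)"
      using x pCons.prems by (intro mult_left_mono) auto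
    moreover have "\<bar>poly (pCons a P) x\<bar> \<le> \<bar>a\<bar> + x * \<bar>poly P x\<bar>"
      using abs_triangle_ineq[of a "x * poly P x"] x by (simp add: abs_mult)
    ultimately show ?thesis using 1 by (simp add: distrib_right)
  qed
  then show ?case using K pCons.prems by (intro exI[of _ "\<bar>a\<bar> + 2 * K / e"]) auto
qed

lemma exp_minus_one_le_half: "exp (- 1) \<le> (1 / 2 :: real)"
  using exp_ge_add_one_self[of 1] by (simp add: exp_minus field_simps)

lemma abs_exp_minus_diff_le:
  fixes a b :: real
  shows "\<bar>exp (- a) - exp (- b)\<bar> \<le> \<bar>a - b\<bar> * max (exp (- a)) (exp (- b))"
proof (induction a b rule: linorder_wlog)
  case (le a b)
  have "exp (- a) - exp (- b) = exp (- a) * (1 - exp (- (b - a)))"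
    by (simp add: right_diff_distrib mult_exp_exp)
  also have "\<dots> \<le> exp (- a) * (b - a)"
  proof (rule mult_left_mono)
    show "1 - exp (- (b - a)) \<le> b - a"
      using exp_ge_add_one_self[of "- (b - a)"] by linarith
  qed simp
  finally show ?case using le by (simp add: mult.commute)
next
  case (sym a b)
  then show ?case by (simp add: abs_minus_commute max.commute)
qed

text \<open>A length function without the requirement that only the identity has length \<open>0\<close>; the
  lengths induced on quotients are of this kind.\<close>

locale group_seminorm = group G for G (structure) +
  fixes L :: "'a \<Rightarrow> real"
  assumes L_nonneg: "x \<in> carrier G \<Longrightarrow> 0 \<le> L x"
    and L_one: "L \<one> = 0"
    and L_inv: "x \<in> carrier G \<Longrightarrow> L (inv x) = L x"
    and L_mult: "x \<in> carrier G \<Longrightarrow> y \<in> carrier G \<Longrightarrow> L (x \<otimes> y) \<le> L x + L y"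
begin

abbreviation d :: "'a \<Rightarrow> 'a \<Rightarrow> real" where
  "d \<equiv> length_dist G L"

lemma d_nonneg: "x \<in> carrier G \<Longrightarrow> y \<in> carrier G \<Longrightarrow> 0 \<le> d x y"
  by (simp add: length_dist_def L_nonneg)

lemma d_self: "x \<in> carrier G \<Longrightarrow> d x x = 0"
  by (simp add: length_dist_def L_one)

lemma d_commute: "x \<in> carrier G \<Longrightarrow> y \<in> carrier G \<Longrightarrow> d x y = d y x"
  using L_inv[of "inv x \<otimes> y"] by (simp add: length_dist_def inv_mult_group)

lemma d_triangle:
  assumes "x \<in> carrier G" "y \<in> carrier G" "z \<in> carrier G"
  shows "d x z \<le> d x y + d y z"
proof -
  have "inv x \<otimes> z = (inv x \<otimes> y) \<otimes> (inv y \<otimes> z)"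
    using assms by (simp add: m_assoc) (simp add: m_assoc[symmetric])
  then show ?thesis using assms L_mult[of "inv x \<otimes> y" "inv y \<otimes> z"] by (simp add: length_dist_def)
qed

lemma d_diff_le:
  assumes "x \<in> carrier G" "y \<in> carrier G" "z \<in> carrier G"
  shows "\<bar>d x z - d y z\<bar> \<le> d x y"
  using d_triangle[of x y z] d_triangle[of y x z] d_commute[of x y] assms by auto

lemma d_translate: "x \<in> carrier G \<Longrightarrow> g \<in> carrier G \<Longrightarrow> d x (x \<otimes> g) = L g"
  by (simp add: length_dist_def m_assoc[symmetric])

definition closed_ball :: "real \<Rightarrow> 'a \<Rightarrow> 'a set" where
  "closed_ball r x = {g \<in> carrier G. d x g \<le> r}"

lemma bij_betw_closed_ball:
  assumes x: "x \<in> carrier G"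
  shows "bij_betw (\<lambda>g. x \<otimes> g) (closed_ball r \<one>) (closed_ball r x)"
proof (rule bij_betw_byWitness[where f' = "\<lambda>g. inv x \<otimes> g"])
  show "(\<lambda>g. x \<otimes> g) ` closed_ball r \<one> \<subseteq> closed_ball r x"
    using x by (auto simp: closed_ball_def d_translate) (simp add: length_dist_def)
  show "(\<lambda>g. inv x \<otimes> g) ` closed_ball r x \<subseteq> closed_ball r \<one>"
    using x by (auto simp: closed_ball_def length_dist_def)
qed (use x in \<open>auto simp: closed_ball_def m_assoc[symmetric]\<close>)

text \<open>With an exponential profile the change of the weight between the centres \<open>p\<close> and \<open>q\<close> is
  at most \<open>d p q / R\<close> times the larger of the two weights, up to the truncation error \<open>exp (- R)\<close>.
  Subtracting this constant instead of cutting off keeps the profile Lipschitz.\<close>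

definition tent :: "real \<Rightarrow> 'a \<Rightarrow> 'a \<Rightarrow> real" where
  "tent R p g = max 0 (exp (- (d p g / R)) - exp (- R))"

lemma tent_nonneg: "0 \<le> tent R p g"
  by (simp add: tent_def)

lemma tent_eq_0:
  assumes "1 \<le> R" "g \<in> carrier G" "g \<notin> closed_ball (R\<^sup>2) p"
  shows "tent R p g = 0"
proof -
  have "R\<^sup>2 < d p g" using assms by (simp add: closed_ball_def)
  then have "R \<le> d p g / R" using assms(1) by (simp add: field_simps power2_eq_square)
  then show ?thesis by (simp add: tent_def)
qed

text \<open>By left invariance all the weights \<open>tent R p\<close> have the same norm, so that normalising them
  does not make them vary faster.\<close>

lemma sum_tent_translate:
  assumes p: "p \<in> carrier G"
  shows "(\<Sum>g\<in>closed_ball r p. (tent R p g)\<^sup>2) = (\<Sum>g\<in>closed_ball r \<one>. (tent R \<one> g)\<^sup>2)"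
proof -
  have "(\<Sum>g\<in>closed_ball r \<one>. (tent R \<one> g)\<^sup>2) = (\<Sum>g\<in>closed_ball r \<one>. (tent R p (p \<otimes> g))\<^sup>2)"
    using p by (intro sum.cong) (auto simp: closed_ball_def tent_def d_translate length_dist_def[of _ _ \<one>])
  also have "\<dots> = (\<Sum>g\<in>closed_ball r p. (tent R p g)\<^sup>2)"
    using p by (intro sum.reindex_bij_betw bij_betw_closed_ball)
  finally show ?thesis by simp
qed

lemma tent_diff_le:
  assumes pq: "p \<in> carrier G" "q \<in> carrier G" and g: "g \<in> carrier G" and R: "1 \<le> R"
  shows "(tent R p g - tent R q g)\<^sup>2
       \<le> (d p q / R)\<^sup>2 * (2 * ((tent R p g)\<^sup>2 + (tent R q g)\<^sup>2 + (exp (- R))\<^sup>2))"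
proof -
  define a b m where "a = d p g / R" and "b = d q g / R" and "m = max (tent R p g) (tent R q g)"
  have ab: "\<bar>a - b\<bar> \<le> d p q / R"
    using d_diff_le[OF pq g] R
    by (simp add: a_def b_def diff_divide_distrib[symmetric] divide_right_mono)
  have m: "max (exp (- a)) (exp (- b)) \<le> m + exp (- R)"
    unfolding m_def a_def b_def tent_def by linarith
  have "\<bar>tent R p g - tent R q g\<bar> \<le> \<bar>exp (- a) - exp (- b)\<bar>"
    by (simp add: a_def b_def tent_def)
  also have "\<dots> \<le> \<bar>a - b\<bar> * max (exp (- a)) (exp (- b))"
    by (rule abs_exp_minus_diff_le)
  also have "\<dots> \<le> d p q / R * (m + exp (- R))"
    using ab m R by (intro mult_mono) (auto simp: d_nonneg pq max_def)
  finally have "(tent R p g - tent R q g)\<^sup>2 \<le> (d p q / R * (m + exp (- R)))\<^sup>2"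
    by (metis abs_ge_zero power2_abs power_mono)
  also have "\<dots> \<le> (d p q / R)\<^sup>2 * (2 * ((tent R p g)\<^sup>2 + (tent R q g)\<^sup>2 + (exp (- R))\<^sup>2))"
    unfolding power_mult_distrib
  proof (intro mult_left_mono)
    have "(m + exp (- R))\<^sup>2 \<le> 2 * (m\<^sup>2 + (exp (- R))\<^sup>2)"
      using sum_squares_bound[of m "exp (- R)"] by (simp add: power2_sum)
    moreover have "m\<^sup>2 \<le> (tent R p g)\<^sup>2 + (tent R q g)\<^sup>2" by (simp add: m_def max_def)
    ultimately show "(m + exp (- R))\<^sup>2 \<le> 2 * ((tent R p g)\<^sup>2 + (tent R q g)\<^sup>2 + (exp (- R))\<^sup>2)"
      by simp
  qed simp
  finally show ?thesis .
qed

text \<open>Polynomial growth enters in two places only: it makes the balls finite, and it bounds the number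
  of points of a closed_ball of radius \<open>R\<^sup>2\<close> by a multiple of \<open>exp (2 * R)\<close>, which absorbs the truncation
  error.\<close>

theorem polynomial_growth_weights:
  assumes growth: "polynomial_growth (carrier G) d"
  obtains A where "0 \<le> A"
    and "\<And>r p. 0 \<le> r \<Longrightarrow> p \<in> carrier G \<Longrightarrow> finite (closed_ball r p)"
    and "\<And>R. 1 \<le> R \<Longrightarrow> \<exists>\<phi>.
      (\<forall>p g. 0 \<le> \<phi> p g) \<and>
      (\<forall>p\<in>carrier G. \<forall>g\<in>carrier G. g \<notin> closed_ball (R\<^sup>2) p \<longrightarrow> \<phi> p g = 0) \<and>
      (\<forall>p\<in>carrier G. (\<Sum>g\<in>closed_ball (R\<^sup>2) p. (\<phi> p g)\<^sup>2) = 1) \<and>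
      (\<forall>p\<in>carrier G. \<forall>q\<in>carrier G.
        (\<Sum>g\<in>closed_ball (R\<^sup>2) p \<union> closed_ball (R\<^sup>2) q. (\<phi> p g - \<phi> q g)\<^sup>2) \<le> A * (d p q / R)\<^sup>2)"
proof -
  obtain P :: "real poly" where P: "\<And>x r. x \<in> carrier G \<Longrightarrow> 0 \<le> r \<Longrightarrow>
      finite (closed_ball r x) \<and> real (card (closed_ball r x)) \<le> poly P r"
    using growth unfolding polynomial_growth_def closed_ball_def by blast
  have fin: "finite (closed_ball r p)" if "0 \<le> r" "p \<in> carrier G" for r p using P that by blast
  obtain K where K: "K \<ge> 0"
    "\<And>x. 0 \<le> x \<Longrightarrow> \<bar>poly (pcompose P [:0, 0, 1:]) x\<bar> \<le> K * exp (2 * x)"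
    using poly_le_exp[of 2 "pcompose P [:0, 0, 1:]"] by auto
  \<comment> \<open>The polynomial \<open>P (R\<^sup>2)\<close> in \<open>R\<close> grows more slowly than \<open>exp (2 * R)\<close>.\<close>
  have card_ball: "real (card (closed_ball (R\<^sup>2) p)) * (exp (- R))\<^sup>2 \<le> K" if "1 \<le> R" "p \<in> carrier G" for R p
  proof -
    have "real (card (closed_ball (R\<^sup>2) p)) \<le> poly P (R\<^sup>2)" using P that by simp
    also have "\<dots> \<le> K * exp (2 * R)"
      using K(2)[of R] that by (simp add: poly_pcompose power2_eq_square)
    finally have "real (card (closed_ball (R\<^sup>2) p)) * (exp (- R))\<^sup>2 \<le> K * exp (2 * R) * (exp (- R))\<^sup>2"
      by (intro mult_right_mono) auto
    also have "\<dots> = K" by (simp add: power2_eq_square mult_exp_exp mult.assoc)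
    finally show ?thesis .
  qed
  \<comment> \<open>In the sum of the bounds of \<open>tent_diff_le\<close> over both balls, the two weights contribute
    \<open>4 * N\<close> and the truncation errors at most \<open>4 * K\<close>; dividing by \<open>N \<ge> 1 / 4\<close> gives the
    constant.\<close>
  show thesis
  proof (rule that[of "4 * (1 + 4 * K)"])
    fix R :: real assume R: "1 \<le> R"
    define N where "N = (\<Sum>g\<in>closed_ball (R\<^sup>2) \<one>. (tent R \<one> g)\<^sup>2)"
    have Np: "(\<Sum>g\<in>closed_ball (R\<^sup>2) p. (tent R p g)\<^sup>2) = N" if "p \<in> carrier G" for p
      using sum_tent_translate[OF that] by (simp add: N_def)
    have N: "1 / 4 \<le> N"
    proof -
      have "exp (- R) \<le> exp (- 1)" using R by simp
      then have "exp (- R) \<le> 1 / 2" using exp_minus_one_le_half by linarith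
      then have "1 / 2 \<le> tent R \<one> \<one>"
        unfolding tent_def d_self[OF one_closed] by (simp only: minus_zero div_0 exp_zero)
      then have "(1 / 2)\<^sup>2 \<le> (tent R \<one> \<one>)\<^sup>2" by (intro power_mono) auto
      also have "\<dots> \<le> N"
        unfolding N_def using fin[of "R\<^sup>2" \<one>]
        by (intro member_le_sum) (auto simp: closed_ball_def d_self)
      finally show ?thesis by (simp add: power2_eq_square)
    qed
    define \<phi> where "\<phi> p g = tent R p g / sqrt N" for p g
    have var: "(\<Sum>g\<in>closed_ball (R\<^sup>2) p \<union> closed_ball (R\<^sup>2) q. (\<phi> p g - \<phi> q g)\<^sup>2) \<le> 4 * (1 + 4 * K) * (d p q / R)\<^sup>2"
      if pq: "p \<in> carrier G" "q \<in> carrier G" for p q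
    proof -
      let ?U = "closed_ball (R\<^sup>2) p \<union> closed_ball (R\<^sup>2) q"
      have U: "finite ?U" "?U \<subseteq> carrier G" using fin pq by (auto simp: closed_ball_def)
      have norms: "(\<Sum>g\<in>?U. (tent R x g)\<^sup>2) = N" if "x = p \<or> x = q" for x
      proof -
        have "(\<Sum>g\<in>?U. (tent R x g)\<^sup>2) = (\<Sum>g\<in>closed_ball (R\<^sup>2) x. (tent R x g)\<^sup>2)"
          using that U tent_eq_0[OF R] by (intro sum.mono_neutral_right) auto
        then show ?thesis using Np[of x] that pq by auto
      qed
      have "real (card ?U) * (exp (- R))\<^sup>2
          \<le> (real (card (closed_ball (R\<^sup>2) p)) + real (card (closed_ball (R\<^sup>2) q))) * (exp (- R))\<^sup>2"
        using card_Un_le[of "closed_ball (R\<^sup>2) p" "closed_ball (R\<^sup>2) q"] by (intro mult_right_mono) auto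
      also have "\<dots> \<le> 2 * K" using card_ball[OF R pq(1)] card_ball[OF R pq(2)] by (simp add: distrib_right)
      finally have card_U: "real (card ?U) * (exp (- R))\<^sup>2 \<le> 2 * K" .
      have "(\<Sum>g\<in>?U. (\<phi> p g - \<phi> q g)\<^sup>2) = (\<Sum>g\<in>?U. (tent R p g - tent R q g)\<^sup>2) / N"
        using N by (simp add: \<phi>_def diff_divide_distrib[symmetric] power_divide sum_divide_distrib)
      also have "\<dots> \<le> (\<Sum>g\<in>?U. (d p q / R)\<^sup>2 * (2 * ((tent R p g)\<^sup>2 + (tent R q g)\<^sup>2 + (exp (- R))\<^sup>2))) / N"
        using N U by (intro divide_right_mono sum_mono tent_diff_le pq R) auto
      also have "\<dots> = (d p q / R)\<^sup>2 * (2 * (2 * N + real (card ?U) * (exp (- R))\<^sup>2)) / N"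
        by (simp add: sum_distrib_left[symmetric] sum.distrib norms)
      also have "\<dots> \<le> (d p q / R)\<^sup>2 * (2 * (2 * N + 2 * K)) / N"
        using card_U N by (intro divide_right_mono mult_left_mono) auto
      also have "\<dots> = (d p q / R)\<^sup>2 * (4 * (1 + K / N))" using N by (simp add: field_simps)
      also have "\<dots> \<le> (d p q / R)\<^sup>2 * (4 * (1 + 4 * K))"
      proof -
        have "K * 1 \<le> K * (4 * N)" using N K(1) by (intro mult_left_mono) auto
        then have "K / N \<le> 4 * K" using N by (simp add: field_simps)
        then show ?thesis by (intro mult_left_mono) auto
      qed
      finally show ?thesis by (simp add: mult.commute)
    qed
    show "\<exists>\<phi>. (\<forall>p g. 0 \<le> \<phi> p g) \<and>
      (\<forall>p\<in>carrier G. \<forall>g\<in>carrier G. g \<notin> closed_ball (R\<^sup>2) p \<longrightarrow> \<phi> p g = 0) \<and>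
      (\<forall>p\<in>carrier G. (\<Sum>g\<in>closed_ball (R\<^sup>2) p. (\<phi> p g)\<^sup>2) = 1) \<and>
      (\<forall>p\<in>carrier G. \<forall>q\<in>carrier G.
        (\<Sum>g\<in>closed_ball (R\<^sup>2) p \<union> closed_ball (R\<^sup>2) q. (\<phi> p g - \<phi> q g)\<^sup>2) \<le> 4 * (1 + 4 * K) * (d p q / R)\<^sup>2)"
    proof (intro exI[of _ \<phi>] conjI allI ballI impI)
      show "0 \<le> \<phi> p g" for p g using N by (simp add: \<phi>_def tent_nonneg)
      show "\<phi> p g = 0" if "p \<in> carrier G" "g \<in> carrier G" "g \<notin> closed_ball (R\<^sup>2) p" for p g
        using tent_eq_0[OF R that(2,3)] by (simp add: \<phi>_def)
      show "(\<Sum>g\<in>closed_ball (R\<^sup>2) p. (\<phi> p g)\<^sup>2) = 1" if "p \<in> carrier G" for p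
        using N Np[OF that] by (simp add: \<phi>_def power_divide sum_divide_distrib[symmetric])
    qed (rule var)
  qed (use fin K(1) in auto)
qed

end

section \<open>Gluing maps on the fibres\<close>

text \<open>The kernel is the Gram matrix of the vectors whose component at \<open>g\<close> is \<open>\<phi> x g\<close> times a
  vector with Gram matrix \<open>E g\<close>.\<close>

lemma pos_def_on_overlap:
  assumes E: "\<And>g. g \<in> I \<Longrightarrow> pos_def_on X (E g)"
    and B: "\<And>x. x \<in> X \<Longrightarrow> finite (B x)" "\<And>x. x \<in> X \<Longrightarrow> B x \<subseteq> I"
    and zero: "\<And>x g. x \<in> X \<Longrightarrow> g \<in> I \<Longrightarrow> g \<notin> B x \<Longrightarrow> \<phi> x g = 0"
  shows "pos_def_on X (\<lambda>x y. \<Sum>g\<in>B x \<inter> B y. \<phi> x g * \<phi> y g * E g x y)"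
proof (rule pos_def_onI)
  fix x y assume "x \<in> X" "y \<in> X"
  then show "(\<Sum>g\<in>B x \<inter> B y. \<phi> x g * \<phi> y g * E g x y) = (\<Sum>g\<in>B y \<inter> B x. \<phi> y g * \<phi> x g * E g y x)"
    using B(2) by (intro sum.cong) (auto simp: pos_def_on_sym[OF E, of _ y x] subset_iff)
next
  fix S c assume S: "finite S" "S \<subseteq> X"
  define U where "U = (\<Union>x\<in>S. B x)"
  have U: "finite U" "U \<subseteq> I" using S B by (auto simp: U_def)
  have "quad_form (\<lambda>x y. \<Sum>g\<in>B x \<inter> B y. \<phi> x g * \<phi> y g * E g x y) S c
      = quad_form (\<lambda>x y. \<Sum>g\<in>U. \<phi> x g * \<phi> y g * E g x y) S c"
  proof (rule quad_form_cong)
    fix x y assume xy: "x \<in> S" "y \<in> S"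
    have "\<phi> x g * \<phi> y g = 0" if "g \<in> U - B x \<inter> B y" for g
      using zero[of x g] zero[of y g] xy S U that by auto
    then show "(\<Sum>g\<in>B x \<inter> B y. \<phi> x g * \<phi> y g * E g x y) = (\<Sum>g\<in>U. \<phi> x g * \<phi> y g * E g x y)"
      using U(1) xy by (intro sum.mono_neutral_left) (auto simp: U_def)
  qed simp
  also have "\<dots> = (\<Sum>g\<in>U. quad_form (\<lambda>x y. \<phi> x g * \<phi> y g * E g x y) S c)"
    by (rule quad_form_sum)
  also have "0 \<le> \<dots>"
  proof (rule sum_nonneg)
    fix g assume "g \<in> U"
    then have "pos_def_on X (\<lambda>x y. \<phi> x g * \<phi> y g * E g x y)"
      using U by (intro pos_def_on_rescale E) auto
    then show "0 \<le> quad_form (\<lambda>x y. \<phi> x g * \<phi> y g * E g x y) S c"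
      using S by (rule pos_def_on_quad_form)
  qed
  finally show "0 \<le> quad_form (\<lambda>x y. \<Sum>g\<in>B x \<inter> B y. \<phi> x g * \<phi> y g * E g x y) S c" .
qed

lemma one_minus_overlap:
  fixes a b :: "'i \<Rightarrow> real"
  assumes fin: "finite P" "finite Q"
    and a: "\<And>g. g \<in> Q \<Longrightarrow> g \<notin> P \<Longrightarrow> a g = 0" "(\<Sum>g\<in>P. (a g)\<^sup>2) = 1"
    and b: "\<And>g. g \<in> P \<Longrightarrow> g \<notin> Q \<Longrightarrow> b g = 0" "(\<Sum>g\<in>Q. (b g)\<^sup>2) = 1"
  shows "1 - (\<Sum>g\<in>P \<inter> Q. a g * b g) = (\<Sum>g\<in>P \<union> Q. (a g - b g)\<^sup>2) / 2"
proof -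
  have "(\<Sum>g\<in>P \<union> Q. (a g)\<^sup>2) = (\<Sum>g\<in>P. (a g)\<^sup>2)"
    using fin a by (intro sum.mono_neutral_right) auto
  moreover have "(\<Sum>g\<in>P \<union> Q. (b g)\<^sup>2) = (\<Sum>g\<in>Q. (b g)\<^sup>2)"
    using fin b by (intro sum.mono_neutral_right) auto
  moreover have "(\<Sum>g\<in>P \<union> Q. a g * b g) = (\<Sum>g\<in>P \<inter> Q. a g * b g)"
    using fin a b by (intro sum.mono_neutral_right) auto
  ultimately show ?thesis
    using a(2) b(2) by (simp add: power2_diff sum.distrib sum_subtractf sum_distrib_left[symmetric] mult.assoc)
qed

lemma power_power_commute: "((a::'a::monoid_mult) ^ m) ^ n = (a ^ n) ^ m"
  by (simp add: power_mult[symmetric] mult.commute)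

text \<open>Here \<open>I\<close> indexes copies of \<open>Y\<close>, the fibres, and \<open>h g\<close> moves the points of \<open>X\<close> into the
  fibre over \<open>g\<close>.  At scale \<open>n\<close> a point \<open>x\<close> uses the fibres in \<open>B n x\<close> with the weights
  \<open>\<phi> n x\<close>, whose rate of variation is \<open>4 ^ -n\<close>, and the projections distort distances by about
  \<open>T = 16 ^ n\<close>.  On each fibre the given embedding \<open>f\<close> enters through the Gaussian kernel of
  width parameter \<open>T ^ -3 = 4096 ^ -n\<close>, which turns it into a bounded map.

  Let \<open>k n\<close> be the resulting normalised kernel.  The variation of the weights contributes
  at most a multiple of \<open>d\<^sup>2 / T\<close> to \<open>1 - k n\<close>, and the Gaussians contribute at most a
  multiple of \<open>(d\<^sup>2 + T\<^sup>2) / T ^ 3\<close>.  Both are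
  absorbed by \<open>(d\<^sup>2 + 1) / T\<close>, so \<open>\<Psi> = (\<Sum>n. 8 ^ n * (1 - k n))\<close> is bounded by a multiple of
  \<open>d\<^sup>2 + 1\<close>.  Conversely \<open>k n\<close> drops to \<open>1 / 2\<close> as soon as \<open>d ^ e\<close> exceeds a multiple of
  \<open>sqrt (T ^ 3) = 64 ^ n\<close>.  As \<open>8 ^ n\<close> is the square root of \<open>64 ^ n\<close>, the last such \<open>n\<close>
  makes \<open>\<Psi>\<close> at least a multiple of \<open>d ^ (e / 2)\<close>, the square of \<open>d ^ (e / 4)\<close>.\<close>

theorem fibred_compression_exponent:
  fixes X :: "'a set" and Y :: "'y set" and I :: "'i set" and V :: "(real, 'v) module"
    and e A :: real
  assumes comp: "hilbert_space V ip" "compresses_into Y dY e V ip" and e: "0 < e" "e \<le> 1"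
    and X: "X \<noteq> {}" and d_nonneg: "\<And>x y. x \<in> X \<Longrightarrow> y \<in> X \<Longrightarrow> 0 \<le> d x y"
    and h: "\<And>g x. g \<in> I \<Longrightarrow> x \<in> X \<Longrightarrow> h g x \<in> Y"
    and B: "\<And>n x. x \<in> X \<Longrightarrow> finite (B n x)" "\<And>n x. x \<in> X \<Longrightarrow> B n x \<subseteq> I"
    and near: "\<And>n x y g. x \<in> X \<Longrightarrow> y \<in> X \<Longrightarrow> g \<in> B n x \<Longrightarrow> g \<in> B n y \<Longrightarrow>
      \<bar>dY (h g x) (h g y) - d x y\<bar> \<le> 2 * 16 ^ n + 2"
    and \<phi>_nonneg: "\<And>n x g. 0 \<le> \<phi> n x g"
    and \<phi>_zero: "\<And>n x g. x \<in> X \<Longrightarrow> g \<in> I \<Longrightarrow> g \<notin> B n x \<Longrightarrow> \<phi> n x g = 0"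
    and \<phi>_unit: "\<And>n x. x \<in> X \<Longrightarrow> (\<Sum>g\<in>B n x. (\<phi> n x g)\<^sup>2) = 1"
    and \<phi>_diff: "\<And>n x y. x \<in> X \<Longrightarrow> y \<in> X \<Longrightarrow>
      (\<Sum>g\<in>B n x \<union> B n y. (\<phi> n x g - \<phi> n y g)\<^sup>2) \<le> A * (d x y / 4 ^ n)\<^sup>2"
    and A: "0 \<le> A"
  shows "e / 4 \<in> compression_exponents X d"
proof -
  interpret V: hilbert_space V ip by (rule comp(1))
  obtain f C C' D D' where f: "f \<in> Y \<rightarrow> carrier V"
    and C: "C > 0" "C' > 0" "D \<ge> 0" "D' \<ge> 0"
    and low: "\<And>x y. x \<in> Y \<Longrightarrow> y \<in> Y \<Longrightarrow> 1 / C' * dY x y powr e - D' \<le> V.vnorm (f x \<ominus>\<^bsub>V\<^esub> f y)"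
    and up: "\<And>x y. x \<in> Y \<Longrightarrow> y \<in> Y \<Longrightarrow> V.vnorm (f x \<ominus>\<^bsub>V\<^esub> f y) \<le> C * dY x y + D"
    using comp(2) unfolding compresses_into_def by blast
  define s where "s g x y = V.vnorm (f (h g x) \<ominus>\<^bsub>V\<^esub> f (h g y))" for g x y
  have s_nonneg: "0 \<le> s g x y" if "g \<in> I" "x \<in> X" "y \<in> X" for g x y
    unfolding s_def V.vnorm_def using h that f
    by (intro real_sqrt_ge_zero V.ip_nonneg V.M.minus_closed) auto
  define E where "E n g x y = exp (- (1 / 4096 ^ n) * (s g x y)\<^sup>2)" for n :: nat and g x y
  define k where "k n x y = (\<Sum>g\<in>B n x \<inter> B n y. \<phi> n x g * \<phi> n y g * E n g x y)" for n x y
  have k_pos_def: "pos_def_on X (k n)" for n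
    unfolding k_def
  proof (rule pos_def_on_overlap)
    show "pos_def_on X (E n g)" if "g \<in> I" for g
      unfolding E_def s_def using f h that by (intro V.pos_def_on_Gaussian) auto
  qed (use B \<phi>_zero in auto)
  have k_diag: "k n x x = 1" if "x \<in> X" for n x
  proof -
    have "E n g x x = 1" if "g \<in> I" for g
    proof -
      have "f (h g x) \<in> carrier V" using f h \<open>x \<in> X\<close> that by auto
      then show ?thesis
        using V.ip_zero_left[OF V.M.zero_closed] by (simp add: E_def s_def V.vnorm_def a_minus_def V.M.r_neg)
    qed
    then have "k n x x = (\<Sum>g\<in>B n x. (\<phi> n x g)\<^sup>2)"
      unfolding k_def using B(2)[OF that] by (intro sum.cong) (auto simp: power2_eq_square subset_iff)
    then show ?thesis using \<phi>_unit[OF that] by simp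
  qed
  have overlap: "1 - (\<Sum>g\<in>B n x \<inter> B n y. \<phi> n x g * \<phi> n y g)
      = (\<Sum>g\<in>B n x \<union> B n y. (\<phi> n x g - \<phi> n y g)\<^sup>2) / 2" if "x \<in> X" "y \<in> X" for n x y
    using that B(1) \<phi>_unit \<phi>_zero[of _ _ n] B(2)[of _ n] by (intro one_minus_overlap) blast+
  have overlap_le: "(\<Sum>g\<in>B n x \<inter> B n y. \<phi> n x g * \<phi> n y g) \<le> 1" if "x \<in> X" "y \<in> X" for n x y
  proof -
    have "0 \<le> (\<Sum>g\<in>B n x \<union> B n y. (\<phi> n x g - \<phi> n y g)\<^sup>2)" by (intro sum_nonneg) auto
    then show ?thesis using overlap[OF that, of n] by simp
  qed
  have k_le: "k n x y \<le> m" if xy: "x \<in> X" "y \<in> X" and m: "0 \<le> m"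
    and E: "\<And>g. g \<in> B n x \<inter> B n y \<Longrightarrow> E n g x y \<le> m" for n x y m
  proof -
    have "k n x y \<le> (\<Sum>g\<in>B n x \<inter> B n y. \<phi> n x g * \<phi> n y g * m)"
      unfolding k_def using E \<phi>_nonneg by (intro sum_mono mult_left_mono) auto
    also have "\<dots> = (\<Sum>g\<in>B n x \<inter> B n y. \<phi> n x g * \<phi> n y g) * m"
      by (simp add: sum_distrib_right)
    also have "\<dots> \<le> m" using mult_right_mono[OF overlap_le[OF xy] m, of n] by simp
    finally show ?thesis .
  qed
  define M1 where "M1 = 4 * C + D"
  define b where "b = A + 2 * M1\<^sup>2"
  have M1: "0 < M1" using C by (simp add: M1_def)
  have b: "0 < b" using A M1 by (simp add: b_def add_nonneg_pos)
  have k_ge: "1 - k n x y \<le> b * ((d x y)\<^sup>2 + 1) / 16 ^ n" if xy: "x \<in> X" "y \<in> X" for n x y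
  proof -
    define T :: real where "T = 16 ^ n"
    define m where "m = 2 * M1\<^sup>2 * ((d x y)\<^sup>2 + 1) / T"
    have T: "1 \<le> T" by (simp add: T_def)
    have E: "1 - E n g x y \<le> m" if g: "g \<in> B n x" "g \<in> B n y" for g
    proof -
      have gI: "g \<in> I" using B(2) xy g by auto
      have "s g x y \<le> C * dY (h g x) (h g y) + D"
        unfolding s_def using h[OF gI] xy by (intro up) auto
      also have "\<dots> \<le> C * (d x y + 2 * T + 2) + D * 1"
        using near[OF xy g] C by (intro add_mono mult_left_mono) (auto simp: T_def)
      also have "\<dots> \<le> C * (4 * (d x y + T)) + D * (d x y + T)"
        using T C d_nonneg[OF xy] by (intro add_mono mult_left_mono) auto
      also have "\<dots> = M1 * (d x y + T)" by (simp add: M1_def algebra_simps)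
      finally have "(s g x y)\<^sup>2 \<le> (M1 * (d x y + T))\<^sup>2"
        using s_nonneg[OF gI xy] by (intro power_mono)
      also have "\<dots> \<le> M1\<^sup>2 * (2 * ((d x y)\<^sup>2 + T\<^sup>2))"
        unfolding power_mult_distrib using sum_squares_bound[of "d x y" T]
        by (intro mult_left_mono) (auto simp: power2_sum)
      finally have s: "(s g x y)\<^sup>2 \<le> 2 * M1\<^sup>2 * ((d x y)\<^sup>2 + T\<^sup>2)"
        by (simp only: mult_ac)
      have "4096 ^ n = T ^ 3"
        using power_power_commute[of "16::real" 3 n] by (simp add: T_def)
      then have "1 - E n g x y \<le> (s g x y)\<^sup>2 / T ^ 3"
        using exp_ge_add_one_self[of "- ((s g x y)\<^sup>2 / T ^ 3)"] by (simp add: E_def)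
      also have "\<dots> \<le> 2 * M1\<^sup>2 * ((d x y)\<^sup>2 + T\<^sup>2) / T ^ 3"
        using s T by (intro divide_right_mono) auto
      also have "\<dots> \<le> 2 * M1\<^sup>2 * (((d x y)\<^sup>2 + 1) * T\<^sup>2) / T ^ 3"
      proof -
        have "(d x y)\<^sup>2 * 1 \<le> (d x y)\<^sup>2 * T\<^sup>2" using T by (intro mult_left_mono) (auto simp: one_le_power)
        then show ?thesis using T
          by (intro divide_right_mono mult_left_mono) (auto simp: distrib_right)
      qed
      also have "\<dots> = m" using T by (simp add: m_def power2_eq_square power3_eq_cube)
      finally show ?thesis .
    qed
    have m: "0 \<le> m" using T by (simp add: m_def)
    have "1 - k n x y = 1 - (\<Sum>g\<in>B n x \<inter> B n y. \<phi> n x g * \<phi> n y g)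
        + (\<Sum>g\<in>B n x \<inter> B n y. \<phi> n x g * \<phi> n y g * (1 - E n g x y))"
      by (simp add: k_def right_diff_distrib sum_subtractf)
    also have "\<dots> \<le> A * (d x y / 4 ^ n)\<^sup>2 / 2 + (\<Sum>g\<in>B n x \<inter> B n y. \<phi> n x g * \<phi> n y g * m)"
      unfolding overlap[OF xy] using E \<phi>_nonneg \<phi>_diff[OF xy]
      by (intro add_mono divide_right_mono sum_mono mult_left_mono) auto
    also have "\<dots> = A * (d x y)\<^sup>2 / 2 / T + (\<Sum>g\<in>B n x \<inter> B n y. \<phi> n x g * \<phi> n y g) * m"
      by (simp add: T_def power_divide sum_distrib_right power_power_commute[of 4 n 2])
    also have "\<dots> \<le> A * (d x y)\<^sup>2 / 2 / T + 1 * m"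
      using m overlap_le[OF xy] by (intro add_left_mono mult_right_mono)
    also have "\<dots> = (A * (d x y)\<^sup>2 / 2 + 2 * M1\<^sup>2 * ((d x y)\<^sup>2 + 1)) / T"
      by (simp add: m_def add_divide_distrib)
    also have "\<dots> \<le> (b * ((d x y)\<^sup>2 + 1)) / T"
    proof -
      have "A * (d x y)\<^sup>2 / 2 \<le> A * ((d x y)\<^sup>2 + 1)"
        using A mult_nonneg_nonneg[OF A zero_le_power2[of "d x y"]] by (simp add: distrib_left)
      then show ?thesis using T by (intro divide_right_mono) (auto simp: b_def distrib_right)
    qed
    finally show ?thesis by (simp add: T_def)
  qed
  define \<Psi> where "\<Psi> x y = (\<Sum>n. 8 ^ n * (1 - k n x y))" for x y
  have k_le_1: "k n x y \<le> 1" if "x \<in> X" "y \<in> X" for n x y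
    using that by (intro k_le) (auto simp: E_def)
  have term_le: "8 ^ n * (1 - k n x y) \<le> b * ((d x y)\<^sup>2 + 1) * (1 / 2) ^ n" if xy: "x \<in> X" "y \<in> X" for n x y
  proof -
    have "8 ^ n * (1 - k n x y) \<le> 8 ^ n * (b * ((d x y)\<^sup>2 + 1) / 16 ^ n)"
      using k_ge[OF xy] by (intro mult_left_mono) auto
    also have "\<dots> = b * ((d x y)\<^sup>2 + 1) * (8 / 16) ^ n" unfolding power_divide by simp
    finally show ?thesis by simp
  qed
  have geo: "(\<lambda>n. b * ((d x y)\<^sup>2 + 1) * (1 / 2) ^ n) sums (2 * b * ((d x y)\<^sup>2 + 1))" for x y
    using sums_mult[OF geometric_sums[of "1 / 2 :: real"], of "b * ((d x y)\<^sup>2 + 1)"] by (simp add: mult_ac)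
  have summ: "summable (\<lambda>n. 8 ^ n * (1 - k n x y))" if xy: "x \<in> X" "y \<in> X" for x y
  proof (rule summable_comparison_test'[OF sums_summable[OF geo[of x y]]])
    fix n :: nat
    show "norm (8 ^ n * (1 - k n x y)) \<le> b * ((d x y)\<^sup>2 + 1) * (1 / 2) ^ n"
      using term_le[OF xy, of n] k_le_1[OF xy, of n] by simp
  qed
  have sums: "(\<lambda>n. 8 ^ n * (1 - k n x y)) sums \<Psi> x y" if "x \<in> X" "y \<in> X" for x y
    unfolding \<Psi>_def using summ[OF that] by (rule summable_sums)
  have "cond_neg_def_on X \<Psi>"
    by (rule cond_neg_def_on_weighted_sums[OF k_pos_def k_diag _ sums]) auto
  then obtain W :: "(real, 'a \<Rightarrow> real) module" and ip' and F :: "'a \<Rightarrow> 'a \<Rightarrow> real"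
    where W: "hilbert_space W ip'" and F: "F \<in> X \<rightarrow> carrier W"
      and dist: "\<And>x y. x \<in> X \<Longrightarrow> y \<in> X \<Longrightarrow> (real_inner_space.vnorm ip' (F x \<ominus>\<^bsub>W\<^esub> F y))\<^sup>2 = \<Psi> x y"
    using cond_neg_def_embedding[OF _ X] by blast
  interpret W: hilbert_space W ip' by (rule W)
  have W_nonneg: "0 \<le> W.vnorm (F x \<ominus>\<^bsub>W\<^esub> F y)" if "x \<in> X" "y \<in> X" for x y
    unfolding W.vnorm_def using F that by (intro real_sqrt_ge_zero W.ip_nonneg W.M.minus_closed) auto

  have upper: "W.vnorm (F x \<ominus>\<^bsub>W\<^esub> F y) \<le> sqrt (2 * b) * d x y + sqrt (2 * b)" if xy: "x \<in> X" "y \<in> X" for x y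
  proof (rule power2_le_imp_le)
    have "(W.vnorm (F x \<ominus>\<^bsub>W\<^esub> F y))\<^sup>2 \<le> 2 * b * ((d x y)\<^sup>2 + 1)"
      unfolding dist[OF xy] using sums_le[OF _ sums[OF xy] geo] term_le[OF xy] by blast
    also have "\<dots> \<le> 2 * b * (d x y + 1)\<^sup>2"
      using b d_nonneg[OF xy] by (intro mult_left_mono) (auto simp: power2_sum)
    also have "\<dots> = (sqrt (2 * b) * d x y + sqrt (2 * b))\<^sup>2"
    proof -
      have "sqrt (2 * b) * d x y + sqrt (2 * b) = sqrt (2 * b) * (d x y + 1)" by (simp add: distrib_left)
      then show ?thesis using b by (simp only: power_mult_distrib) simp
    qed
    finally show "(W.vnorm (F x \<ominus>\<^bsub>W\<^esub> F y))\<^sup>2 \<le> (sqrt (2 * b) * d x y + sqrt (2 * b))\<^sup>2" .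
  qed (use b d_nonneg[OF xy] in auto)

  \<comment> \<open>The bound \<open>4\<close> keeps \<open>d / 2\<close> above the distortion \<open>2 * 16 ^ n + 2\<close> of the projections; the other
    bound beats the additive constant \<open>D'\<close>.\<close>
  define M where "M = max 4 (C' * (D' + 1))"
  have M: "4 \<le> M" "C' * (D' + 1) \<le> M" by (auto simp: M_def)
  have far: "k n x y \<le> 1 / 2" if xy: "x \<in> X" "y \<in> X" and n: "M * 64 ^ n \<le> (d x y / 2) powr e" for n x y
  proof (rule k_le[OF xy])
    fix g assume "g \<in> B n x \<inter> B n y"
    then have g: "g \<in> B n x" "g \<in> B n y" by auto
    then have gI: "g \<in> I" using B(2) xy by auto
    have "4 * 64 ^ n \<le> M * 64 ^ n" using M by (intro mult_right_mono) auto
    then have p4: "4 * 64 ^ n \<le> (d x y / 2) powr e" using n by (rule order_trans)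
    have "(1::real) \<le> 64 ^ n" by simp
    then have p1: "1 < (d x y / 2) powr e" using p4 by linarith
    have d2: "1 \<le> d x y / 2"
    proof (rule ccontr)
      assume "\<not> 1 \<le> d x y / 2"
      then have "(d x y / 2) powr e \<le> 1 powr e"
        using d_nonneg[OF xy] e by (intro powr_mono2) auto
      then show False using p1 by simp
    qed
    then have "(d x y / 2) powr e \<le> (d x y / 2) powr 1" using e by (intro powr_mono) auto
    then have "4 * 64 ^ n \<le> d x y / 2" using p4 d2 by simp
    moreover have "(16::real) ^ n \<le> 64 ^ n" by (intro power_mono) auto
    moreover have "(1::real) \<le> 16 ^ n" by simp
    ultimately have dY: "d x y / 2 \<le> dY (h g x) (h g y)"
      using near[OF xy g] by linarith
    have "C' * ((D' + 1) * 64 ^ n) \<le> M * 64 ^ n"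
      using M(2) by (simp add: mult.assoc[symmetric] mult_right_mono)
    also have "\<dots> \<le> dY (h g x) (h g y) powr e"
      using n powr_mono2[OF _ _ dY, of e] d2 e by linarith
    finally have "(D' + 1) * 64 ^ n \<le> 1 / C' * dY (h g x) (h g y) powr e"
      using C(2) by (simp add: field_simps)
    moreover have "D' * 1 \<le> D' * 64 ^ n" using C by (intro mult_left_mono) auto
    ultimately have "64 ^ n \<le> s g x y"
      using low[OF h[OF gI xy(1)] h[OF gI xy(2)]] unfolding s_def distrib_right by linarith
    then have "(64 ^ n)\<^sup>2 \<le> (s g x y)\<^sup>2" by (intro power_mono) auto
    also have "(64 ^ n)\<^sup>2 = (4096 ^ n :: real)"
      using power_power_commute[of "64::real" 2 n] by simp
    finally have "1 \<le> (s g x y)\<^sup>2 / 4096 ^ n" by simp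
    then have "E n g x y \<le> exp (- 1)" by (simp add: E_def)
    then show "E n g x y \<le> 1 / 2" using exp_minus_one_le_half by linarith
  qed simp
  define C'' where "C'' = 4 * 2 powr (e / 4) * M powr (1 / 4)"
  have C'': "0 < C''" using M by (simp add: C''_def)
  have lower: "1 / C'' * d x y powr (e / 4) - 1 \<le> W.vnorm (F x \<ominus>\<^bsub>W\<^esub> F y)" if xy: "x \<in> X" "y \<in> X" for x y
  proof -
    define q where "q = (d x y / 2) powr e / M"
    define z where "z = q powr (1 / 4)"
    have q: "0 \<le> q" using M by (simp add: q_def)
    have z: "0 \<le> z" by (simp add: z_def)
    have "z powr 4 = q" using q by (simp add: z_def powr_powr)
    then have z4: "z ^ 4 = q" using z by (subst (asm) powr_numeral)
    have "1 / C'' * d x y powr (e / 4) = z / 4"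
      using d_nonneg[OF xy] M by (simp add: C''_def z_def q_def powr_divide powr_mult powr_powr)
    moreover have "z / 4 - 1 \<le> W.vnorm (F x \<ominus>\<^bsub>W\<^esub> F y)"
      \<comment> \<open>For \<open>q < 1\<close> no scale separates \<open>x\<close> and \<open>y\<close>, and the additive constant absorbs the claim.\<close>
    proof (cases "q < 1")
      case True
      then have "z \<le> 1" using q by (simp add: z_def powr_le1)
      then show ?thesis using W_nonneg[OF xy] by simp
    next
      case False
      obtain N :: nat where "q < 64 ^ N" using real_arch_pow[of 64 q] by auto
      then obtain n where n: "64 ^ n \<le> q" "q < 64 ^ Suc n"
        using False ex_least_nat_less[of "\<lambda>n. q < 64 ^ n" N] by (auto simp: not_less)
      have "M * 64 ^ n \<le> (d x y / 2) powr e"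
        using n(1) M by (simp add: q_def field_simps)
      then have "8 ^ n / 2 \<le> 8 ^ n * (1 - k n x y)"
        using far[OF xy] mult_left_mono[of "1 / 2" "1 - k n x y" "8 ^ n"] by simp
      also have "\<dots> \<le> \<Psi> x y"
        unfolding \<Psi>_def using sum_le_suminf[OF summ[OF xy], of "{n}"] k_le_1[OF xy] by simp
      finally have "8 ^ n / 2 \<le> (W.vnorm (F x \<ominus>\<^bsub>W\<^esub> F y))\<^sup>2" by (simp add: dist[OF xy])
      moreover have "z\<^sup>2 < 8 ^ Suc n"
      proof (rule power2_less_imp_less)
        have "(z\<^sup>2)\<^sup>2 = q" using z4 by simp
        also have "\<dots> < 64 ^ Suc n" by (rule n(2))
        also have "\<dots> = (8 ^ Suc n)\<^sup>2" by (simp add: power_mult_distrib[symmetric] power2_eq_square)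
        finally show "(z\<^sup>2)\<^sup>2 < (8 ^ Suc n)\<^sup>2" .
      qed simp
      ultimately have "(z / 4)\<^sup>2 \<le> (W.vnorm (F x \<ominus>\<^bsub>W\<^esub> F y))\<^sup>2" by (simp add: power_divide)
      then have "z / 4 \<le> W.vnorm (F x \<ominus>\<^bsub>W\<^esub> F y)"
        using W_nonneg[OF xy] by (rule power2_le_imp_le)
      then show ?thesis by simp
    qed
    ultimately show ?thesis by (simp only:)
  qed
  have "compresses_into X d (e / 4) W ip'"
    unfolding compresses_into_def
    using F C'' b upper lower
    by (intro bexI[of _ F] exI[of _ "sqrt (2 * b)"] exI[of _ C''] exI[of _ 1]) auto
  then show ?thesis
    using W e by (intro compression_exponentI) auto
qed

section \<open>Group extensions\<close>

lemma quotient_length_approx: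
  assumes l: "\<And>x. x \<in> carrier \<Gamma> \<Longrightarrow> 0 \<le> l x"
    and l\<^sub>G: "\<And>x. x \<in> carrier \<Gamma> \<Longrightarrow> l\<^sub>G (\<pi> x) = Inf {l y | y. y \<in> carrier \<Gamma> \<and> \<pi> y = \<pi> x}"
    and x: "x \<in> carrier \<Gamma>"
  shows "0 \<le> l\<^sub>G (\<pi> x)" and "l\<^sub>G (\<pi> x) \<le> l x"
    and "0 < e \<Longrightarrow> \<exists>y\<in>carrier \<Gamma>. \<pi> y = \<pi> x \<and> l y < l\<^sub>G (\<pi> x) + (e::real)"
proof -
  let ?L = "{l y | y. y \<in> carrier \<Gamma> \<and> \<pi> y = \<pi> x}"
  have ne: "?L \<noteq> {}" and bdd: "bdd_below ?L"
    using x l by (auto intro!: bdd_belowI[of _ 0])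
  show "0 \<le> l\<^sub>G (\<pi> x)" unfolding l\<^sub>G[OF x] using ne l by (intro cInf_greatest) auto
  show "l\<^sub>G (\<pi> x) \<le> l x" unfolding l\<^sub>G[OF x] using x by (intro cInf_lower bdd) auto
  assume "0 < e"
  then have "Inf ?L < l\<^sub>G (\<pi> x) + e" using l\<^sub>G[OF x] by simp
  then show "\<exists>y\<in>carrier \<Gamma>. \<pi> y = \<pi> x \<and> l y < l\<^sub>G (\<pi> x) + e"
    using cInf_lessD[OF ne] by auto
qed

text \<open>The quotient length may vanish away from the identity, so it is in general only a seminorm.\<close>

lemma quotient_group_seminorm:
  assumes \<Gamma>: "group \<Gamma>" and G: "group G" and \<pi>: "\<pi> \<in> hom \<Gamma> G" and surj: "\<pi> ` carrier \<Gamma> = carrier G"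
    and l: "length_function \<Gamma> l"
    and l\<^sub>G: "\<And>x. x \<in> carrier \<Gamma> \<Longrightarrow> l\<^sub>G (\<pi> x) = Inf {l y | y. y \<in> carrier \<Gamma> \<and> \<pi> y = \<pi> x}"
  shows "group_seminorm G l\<^sub>G"
proof -
  interpret \<pi>: group_hom \<Gamma> G \<pi>
    using \<Gamma> G \<pi> by (simp add: group_hom_def group_hom_axioms_def)
  have l_nonneg: "0 \<le> l x" if "x \<in> carrier \<Gamma>" for x
    using l that by (simp add: length_function_def)
  note approx = quotient_length_approx[where l = l and l\<^sub>G = l\<^sub>G and \<pi> = \<pi>, OF l_nonneg l\<^sub>G]
  have inv_le: "l\<^sub>G (inv\<^bsub>G\<^esub> g) \<le> l\<^sub>G g" if g: "g \<in> carrier G" for g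
  proof (rule field_le_epsilon)
    fix e :: real assume "0 < e"
    then obtain x where x: "x \<in> carrier \<Gamma>" "\<pi> x = g" "l x < l\<^sub>G g + e"
      using approx(3)[of _ e] g surj by (metis imageE)
    have "l\<^sub>G (inv\<^bsub>G\<^esub> g) \<le> l (inv\<^bsub>\<Gamma>\<^esub> x)"
      using approx(2)[of "inv\<^bsub>\<Gamma>\<^esub> x"] x by simp
    also have "\<dots> = l x" using l x by (simp add: length_function_def)
    finally show "l\<^sub>G (inv\<^bsub>G\<^esub> g) \<le> l\<^sub>G g + e" using x by simp
  qed
  show ?thesis
  proof (rule group_seminorm.intro[OF G], unfold_locales)
    fix g assume g: "g \<in> carrier G"
    show "0 \<le> l\<^sub>G g" using approx(1) g surj by (metis imageE)
    show "l\<^sub>G (inv\<^bsub>G\<^esub> g) = l\<^sub>G g"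
      using inv_le[OF g] inv_le[of "inv\<^bsub>G\<^esub> g"] g by simp
    fix h assume h: "h \<in> carrier G"
    show "l\<^sub>G (g \<otimes>\<^bsub>G\<^esub> h) \<le> l\<^sub>G g + l\<^sub>G h"
    proof (rule field_le_epsilon)
      fix e :: real assume e: "0 < e"
      obtain x where x: "x \<in> carrier \<Gamma>" "\<pi> x = g" "l x < l\<^sub>G g + e / 2"
        using approx(3)[of _ "e / 2"] g surj e by (metis half_gt_zero imageE)
      obtain y where y: "y \<in> carrier \<Gamma>" "\<pi> y = h" "l y < l\<^sub>G h + e / 2"
        using approx(3)[of _ "e / 2"] h surj e by (metis half_gt_zero imageE)
      have "l\<^sub>G (g \<otimes>\<^bsub>G\<^esub> h) \<le> l (x \<otimes>\<^bsub>\<Gamma>\<^esub> y)"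
        using approx(2)[of "x \<otimes>\<^bsub>\<Gamma>\<^esub> y"] x y by simp
      also have "\<dots> \<le> l x + l y" using l x y by (simp add: length_function_def)
      finally show "l\<^sub>G (g \<otimes>\<^bsub>G\<^esub> h) \<le> l\<^sub>G g + l\<^sub>G h + e" using x y by simp
    qed
  next
    have "l \<one>\<^bsub>\<Gamma>\<^esub> = 0" using l by (simp add: length_function_def)
    then show "l\<^sub>G \<one>\<^bsub>G\<^esub> = 0"
      using approx(1)[of "\<one>\<^bsub>\<Gamma>\<^esub>"] approx(2)[of "\<one>\<^bsub>\<Gamma>\<^esub>"] by simp
  qed
qed

text \<open>Right translation moves a point by the length of the translating element, so this is the
  triangle inequality.\<close>

lemma (in group) length_translate_le:
  assumes l: "length_function G l" and x: "x \<in> carrier G" "y \<in> carrier G"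
    and a: "a \<in> carrier G" "b \<in> carrier G"
  shows "\<bar>length_dist G l (x \<otimes> a) (y \<otimes> b) - length_dist G l x y\<bar> \<le> l a + l b"
proof -
  have inv: "l (inv z) = l z" and mult: "w \<in> carrier G \<Longrightarrow> l (z \<otimes> w) \<le> l z + l w"
    if "z \<in> carrier G" for z w
    using l that by (auto simp: length_function_def)
  define z where "z = inv x \<otimes> y"
  define w where "w = inv (x \<otimes> a) \<otimes> (y \<otimes> b)"
  have c: "z \<in> carrier G" "w \<in> carrier G" using x a by (auto simp: z_def w_def)
  have w: "w = inv a \<otimes> z \<otimes> b"
    using x a by (simp add: w_def z_def inv_mult_group m_assoc)
  then have z: "z = a \<otimes> w \<otimes> inv b"
    using c a by (simp add: m_assoc) (simp add: m_assoc[symmetric])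
  have "l w \<le> l a + l z + l b"
    using mult[of "inv a \<otimes> z" b] mult[of "inv a" z] inv[of a] c a by (simp add: w)
  moreover have "l z \<le> l a + l w + l b"
    using mult[of "a \<otimes> w" "inv b"] mult[of a w] inv[of b] c a by (subst z) simp
  ultimately show ?thesis by (simp add: length_dist_def w_def z_def abs_le_iff)
qed

text \<open>The fibres of \<open>\<pi>\<close> are the cosets of the image of \<open>H\<close>, all isometric to \<open>H\<close> by left
  translation.  With a section \<open>s\<close> that is length minimising up to \<open>1\<close>, a point \<open>x\<close> is moved to
  the fibre over \<open>g\<close> by multiplying it on the right with \<open>s ((\<pi> x)\<inverse> g)\<close>, and then into the image
  of \<open>H\<close> by multiplying it on the left with \<open>(s g)\<inverse>\<close>.  The former moves it by at most
  \<open>d (\<pi> x) g + 1\<close> and the latter is an isometry.\<close>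

theorem extension_compression_exponent:
  assumes H: "group H" and \<Gamma>: "group \<Gamma>" and G: "group G"
    and \<iota>: "\<iota> \<in> hom H \<Gamma>" "inj_on \<iota> (carrier H)"
    and \<pi>: "\<pi> \<in> hom \<Gamma> G" "\<pi> ` carrier \<Gamma> = carrier G"
    and exact: "\<iota> ` carrier H = kernel \<Gamma> G \<pi>"
    and l: "length_function \<Gamma> l"
    and l\<^sub>G: "\<And>x. x \<in> carrier \<Gamma> \<Longrightarrow> l\<^sub>G (\<pi> x) = Inf {l y | y. y \<in> carrier \<Gamma> \<and> \<pi> y = \<pi> x}"
    and growth: "polynomial_growth (carrier G) (length_dist G l\<^sub>G)"
    and e: "e \<in> compression_exponents (carrier H) (length_dist H (l \<circ> \<iota>))" "e \<noteq> 0"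
  shows "e / 4 \<in> compression_exponents (carrier \<Gamma>) (length_dist \<Gamma> l)"
proof -
  interpret \<Gamma>: group \<Gamma> by (rule \<Gamma>)
  interpret G: group G by (rule G)
  interpret \<iota>: group_hom H \<Gamma> \<iota>
    using H \<Gamma> \<iota> by (simp add: group_hom_def group_hom_axioms_def)
  interpret \<pi>: group_hom \<Gamma> G \<pi>
    using \<Gamma> G \<pi> by (simp add: group_hom_def group_hom_axioms_def)
  interpret L: group_seminorm G l\<^sub>G
    by (rule quotient_group_seminorm[OF \<Gamma> G \<pi> l l\<^sub>G])
  have l_nonneg: "0 \<le> l x" if "x \<in> carrier \<Gamma>" for x
    using l that by (simp add: length_function_def)
  note approx = quotient_length_approx[where l = l and l\<^sub>G = l\<^sub>G and \<pi> = \<pi>, OF l_nonneg l\<^sub>G]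

  have "\<exists>x\<in>carrier \<Gamma>. \<pi> x = g \<and> l x \<le> l\<^sub>G g + 1" if "g \<in> carrier G" for g
    using approx(3)[of _ 1] that \<pi>(2) by (metis imageE less_imp_le zero_less_one)
  then obtain s where s: "\<And>g. g \<in> carrier G \<Longrightarrow> s g \<in> carrier \<Gamma>"
    "\<And>g. g \<in> carrier G \<Longrightarrow> \<pi> (s g) = g" "\<And>g. g \<in> carrier G \<Longrightarrow> l (s g) \<le> l\<^sub>G g + 1"
    by metis
  define r where "r g x = s (inv\<^bsub>G\<^esub> (\<pi> x) \<otimes>\<^bsub>G\<^esub> g)" for g x
  have r: "r g x \<in> carrier \<Gamma>" "\<pi> (r g x) = inv\<^bsub>G\<^esub> (\<pi> x) \<otimes>\<^bsub>G\<^esub> g"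
    "l (r g x) \<le> length_dist G l\<^sub>G (\<pi> x) g + 1" if "g \<in> carrier G" "x \<in> carrier \<Gamma>" for g x
    using that s by (auto simp: r_def length_dist_def)
  define h where "h g x = inv_into (carrier H) \<iota> (inv\<^bsub>\<Gamma>\<^esub> (s g) \<otimes>\<^bsub>\<Gamma>\<^esub> (x \<otimes>\<^bsub>\<Gamma>\<^esub> r g x))" for g x
  have h: "h g x \<in> carrier H" "\<iota> (h g x) = inv\<^bsub>\<Gamma>\<^esub> (s g) \<otimes>\<^bsub>\<Gamma>\<^esub> (x \<otimes>\<^bsub>\<Gamma>\<^esub> r g x)"
    if g: "g \<in> carrier G" and x: "x \<in> carrier \<Gamma>" for g x
  proof -
    have "\<pi> (inv\<^bsub>\<Gamma>\<^esub> (s g) \<otimes>\<^bsub>\<Gamma>\<^esub> (x \<otimes>\<^bsub>\<Gamma>\<^esub> r g x)) = \<one>\<^bsub>G\<^esub>"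
      using g x s r[OF g x] by (simp add: G.m_assoc[symmetric])
    then have "inv\<^bsub>\<Gamma>\<^esub> (s g) \<otimes>\<^bsub>\<Gamma>\<^esub> (x \<otimes>\<^bsub>\<Gamma>\<^esub> r g x) \<in> \<iota> ` carrier H"
      using g x s r[OF g x] by (simp add: exact kernel_def)
    then show "h g x \<in> carrier H" "\<iota> (h g x) = inv\<^bsub>\<Gamma>\<^esub> (s g) \<otimes>\<^bsub>\<Gamma>\<^esub> (x \<otimes>\<^bsub>\<Gamma>\<^esub> r g x)"
      unfolding h_def by (auto intro: inv_into_into f_inv_into_f)
  qed
  have dist_h: "length_dist H (l \<circ> \<iota>) (h g x) (h g y) = length_dist \<Gamma> l (x \<otimes>\<^bsub>\<Gamma>\<^esub> r g x) (y \<otimes>\<^bsub>\<Gamma>\<^esub> r g y)"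
    if g: "g \<in> carrier G" and x: "x \<in> carrier \<Gamma>" and y: "y \<in> carrier \<Gamma>" for g x y
  proof -
    have "inv\<^bsub>\<Gamma>\<^esub> (\<iota> (h g x)) \<otimes>\<^bsub>\<Gamma>\<^esub> \<iota> (h g y) = inv\<^bsub>\<Gamma>\<^esub> (x \<otimes>\<^bsub>\<Gamma>\<^esub> r g x) \<otimes>\<^bsub>\<Gamma>\<^esub> (y \<otimes>\<^bsub>\<Gamma>\<^esub> r g y)"
    proof -
      have c: "s g \<in> carrier \<Gamma>" "x \<otimes>\<^bsub>\<Gamma>\<^esub> r g x \<in> carrier \<Gamma>" "y \<otimes>\<^bsub>\<Gamma>\<^esub> r g y \<in> carrier \<Gamma>"
        using s r g x y by auto
      have "inv\<^bsub>\<Gamma>\<^esub> (inv\<^bsub>\<Gamma>\<^esub> (s g) \<otimes>\<^bsub>\<Gamma>\<^esub> u) \<otimes>\<^bsub>\<Gamma>\<^esub> (inv\<^bsub>\<Gamma>\<^esub> (s g) \<otimes>\<^bsub>\<Gamma>\<^esub> v) = inv\<^bsub>\<Gamma>\<^esub> u \<otimes>\<^bsub>\<Gamma>\<^esub> v"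
        if "u \<in> carrier \<Gamma>" "v \<in> carrier \<Gamma>" for u v
        using that c(1) by (simp add: \<Gamma>.inv_mult_group \<Gamma>.m_assoc) (simp add: \<Gamma>.m_assoc[symmetric])
      then show ?thesis using c h(2)[OF g x] h(2)[OF g y] by simp
    qed
    then show ?thesis using h[OF g x] h[OF g y] by (simp add: length_dist_def)
  qed

  obtain A where A: "0 \<le> A" and fin: "\<And>r p. 0 \<le> r \<Longrightarrow> p \<in> carrier G \<Longrightarrow> finite (L.closed_ball r p)"
    and weights: "\<And>R. 1 \<le> R \<Longrightarrow> \<exists>\<phi>.
      (\<forall>p g. 0 \<le> \<phi> p g) \<and>
      (\<forall>p\<in>carrier G. \<forall>g\<in>carrier G. g \<notin> L.closed_ball (R\<^sup>2) p \<longrightarrow> \<phi> p g = 0) \<and>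
      (\<forall>p\<in>carrier G. (\<Sum>g\<in>L.closed_ball (R\<^sup>2) p. (\<phi> p g)\<^sup>2) = 1) \<and>
      (\<forall>p\<in>carrier G. \<forall>q\<in>carrier G.
        (\<Sum>g\<in>L.closed_ball (R\<^sup>2) p \<union> L.closed_ball (R\<^sup>2) q. (\<phi> p g - \<phi> q g)\<^sup>2) \<le> A * (L.d p q / R)\<^sup>2)"
    using L.polynomial_growth_weights[OF growth] by blast
  have R2: "(4 ^ n)\<^sup>2 = (16 ^ n :: real)" for n
    using power_power_commute[of "4::real" 2 n] by simp
  define good where "good n \<phi> \<longleftrightarrow> (\<forall>p g. 0 \<le> \<phi> p g) \<and>
      (\<forall>p\<in>carrier G. \<forall>g\<in>carrier G. g \<notin> L.closed_ball (16 ^ n) p \<longrightarrow> \<phi> p g = 0) \<and>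
      (\<forall>p\<in>carrier G. (\<Sum>g\<in>L.closed_ball (16 ^ n) p. (\<phi> p g)\<^sup>2) = 1) \<and>
      (\<forall>p\<in>carrier G. \<forall>q\<in>carrier G.
        (\<Sum>g\<in>L.closed_ball (16 ^ n) p \<union> L.closed_ball (16 ^ n) q. (\<phi> p g - \<phi> q g)\<^sup>2)
          \<le> A * (L.d p q / 4 ^ n)\<^sup>2)" for n :: nat and \<phi>
  have "\<forall>n. \<exists>\<phi>. good n \<phi>"
    using weights[of "4 ^ n" for n, unfolded R2] by (simp add: good_def)
  then obtain \<phi> where "\<And>n. good n (\<phi> n)" by metis
  then have \<phi>: "\<And>n p g. 0 \<le> \<phi> n p g"
    "\<And>n p g. p \<in> carrier G \<Longrightarrow> g \<in> carrier G \<Longrightarrow> g \<notin> L.closed_ball (16 ^ n) p \<Longrightarrow> \<phi> n p g = 0"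
    "\<And>n p. p \<in> carrier G \<Longrightarrow> (\<Sum>g\<in>L.closed_ball (16 ^ n) p. (\<phi> n p g)\<^sup>2) = 1"
    "\<And>n p q. p \<in> carrier G \<Longrightarrow> q \<in> carrier G \<Longrightarrow>
      (\<Sum>g\<in>L.closed_ball (16 ^ n) p \<union> L.closed_ball (16 ^ n) q. (\<phi> n p g - \<phi> n q g)\<^sup>2)
        \<le> A * (L.d p q / 4 ^ n)\<^sup>2"
    unfolding good_def by blast+
  obtain V :: "(real, 'a \<Rightarrow> real) module" and ip where V: "hilbert_space V ip"
    "compresses_into (carrier H) (length_dist H (l \<circ> \<iota>)) e V ip" and e01: "0 < e" "e \<le> 1"
    using e unfolding compression_exponents_def by auto

  show ?thesis
  proof (rule fibred_compression_exponent[OF V e01, where I = "carrier G" and h = h and A = A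
        and B = "\<lambda>n x. L.closed_ball (16 ^ n) (\<pi> x)" and \<phi> = "\<lambda>n x. \<phi> n (\<pi> x)"])
    show "carrier \<Gamma> \<noteq> {}" by auto
    show "0 \<le> length_dist \<Gamma> l x y" if "x \<in> carrier \<Gamma>" "y \<in> carrier \<Gamma>" for x y
      using that by (simp add: length_dist_def l_nonneg)
    show "L.closed_ball (16 ^ n) (\<pi> x) \<subseteq> carrier G" for n x
      by (auto simp: L.closed_ball_def)
  next
    fix n x y g assume xy: "x \<in> carrier \<Gamma>" "y \<in> carrier \<Gamma>"
      and "g \<in> L.closed_ball (16 ^ n) (\<pi> x)" "g \<in> L.closed_ball (16 ^ n) (\<pi> y)"
    then have g: "g \<in> carrier G" "L.d (\<pi> x) g \<le> 16 ^ n" "L.d (\<pi> y) g \<le> 16 ^ n"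
      by (auto simp: L.closed_ball_def)
    show "\<bar>length_dist H (l \<circ> \<iota>) (h g x) (h g y) - length_dist \<Gamma> l x y\<bar> \<le> 2 * 16 ^ n + 2"
      unfolding dist_h[OF g(1) xy]
      using \<Gamma>.length_translate_le[OF l xy r(1)[OF g(1) xy(1)] r(1)[OF g(1) xy(2)]]
        r(3)[OF g(1) xy(1)] r(3)[OF g(1) xy(2)] g(2,3) by linarith
  next
    fix n x y assume xy: "x \<in> carrier \<Gamma>" "y \<in> carrier \<Gamma>"
    have "L.d (\<pi> x) (\<pi> y) \<le> length_dist \<Gamma> l x y"
      using approx(2)[of "inv\<^bsub>\<Gamma>\<^esub> x \<otimes>\<^bsub>\<Gamma>\<^esub> y"] xy by (simp add: length_dist_def)
    then have "A * (L.d (\<pi> x) (\<pi> y) / 4 ^ n)\<^sup>2 \<le> A * (length_dist \<Gamma> l x y / 4 ^ n)\<^sup>2"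
      using A xy by (intro mult_left_mono power_mono divide_right_mono) (auto simp: L.d_nonneg)
    then show "(\<Sum>g\<in>L.closed_ball (16 ^ n) (\<pi> x) \<union> L.closed_ball (16 ^ n) (\<pi> y).
        (\<phi> n (\<pi> x) g - \<phi> n (\<pi> y) g)\<^sup>2) \<le> A * (length_dist \<Gamma> l x y / 4 ^ n)\<^sup>2"
      using \<phi>(4)[of "\<pi> x" "\<pi> y" n] xy by simp
  qed (use A \<phi> fin h in auto)
qed

text \<open>It remains to compare the suprema; the exponent \<open>0\<close> is attained by constant maps.\<close>

theorem theorem1p3:
  fixes H :: "'h monoid" and \<Gamma> :: "'a monoid" and G :: "'b monoid"
    and \<iota> :: "'h \<Rightarrow> 'a" and \<pi> :: "'a \<Rightarrow> 'b"
    and l :: "'a \<Rightarrow> real" and l\<^sub>G :: "'b \<Rightarrow> real" and \<delta> :: real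
  assumes "group H" and "group \<Gamma>" and "group G"
    and "\<iota> \<in> hom H \<Gamma>" and "inj_on \<iota> (carrier H)"
    and "\<pi> \<in> hom \<Gamma> G" and "\<pi> ` carrier \<Gamma> = carrier G"
    and "\<iota> ` carrier H = kernel \<Gamma> G \<pi>"
    and "length_function \<Gamma> l"
    and "\<And>x. x \<in> carrier \<Gamma> \<Longrightarrow> l\<^sub>G (\<pi> x) = Inf {l y | y. y \<in> carrier \<Gamma> \<and> \<pi> y = \<pi> x}"
    and "polynomial_growth (carrier G) (length_dist G l\<^sub>G)"
    and "hilbert_compression (carrier H) (length_dist H (l \<circ> \<iota>)) = \<delta>"
  shows "hilbert_compression (carrier \<Gamma>) (length_dist \<Gamma> l) \<ge> \<delta> / 4"
proof -
  let ?E\<^sub>H = "compression_exponents (carrier H) (length_dist H (l \<circ> \<iota>))"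
  let ?E\<^sub>\<Gamma> = "compression_exponents (carrier \<Gamma>) (length_dist \<Gamma> l)"
  interpret H: group H by (rule assms(1))
  interpret \<Gamma>: group \<Gamma> by (rule assms(2))
  have l_nonneg: "0 \<le> l x" if "x \<in> carrier \<Gamma>" for x
    using assms(9) that by (simp add: length_function_def)
  have zero_H: "0 \<in> ?E\<^sub>H"
    using assms(4) by (intro zero_compression_exponent) (auto simp: length_dist_def l_nonneg hom_in_carrier)
  have zero_\<Gamma>: "0 \<in> ?E\<^sub>\<Gamma>"
    by (rule zero_compression_exponent) (simp add: length_dist_def l_nonneg)
  have bdd: "bdd_above ?E\<^sub>\<Gamma>"
    by (rule bdd_aboveI[of _ 1]) (auto simp: compression_exponents_def)
  have "Sup ?E\<^sub>H \<le> 4 * Sup ?E\<^sub>\<Gamma>"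
  proof (rule cSup_least)
    fix e assume e: "e \<in> ?E\<^sub>H"
    have "e / 4 \<in> ?E\<^sub>\<Gamma>"
    proof (cases "e = 0")
      case True
      then show ?thesis using zero_\<Gamma> by simp
    next
      case False
      with e show ?thesis
        by (intro extension_compression_exponent[OF assms(1-11)])
    qed
    then have "e / 4 \<le> Sup ?E\<^sub>\<Gamma>" using bdd by (rule cSup_upper)
    then show "e \<le> 4 * Sup ?E\<^sub>\<Gamma>" by simp
  qed (use zero_H in auto)
  then show ?thesis using assms(12) by (simp add: hilbert_compression_def)
qed

end
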